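(* Suppose $0<a<1/2$. There exist sets $S_n\subset\partial B(an)$ and a constant $\gamma<0$ such that $\nu(S_n)\to1$ as $n\to\infty$ and $$\lim_{n\to\infty}\frac1n\log\frac{|S_n|}{|\partial B(an)|}=\gamma<0 .$$
   Context: $\mathcal S_n$ is the set of permutations of $\{1,\dots,n\}$, with $d(\sigma)$ the distance from the identity $I$ to $\sigma$ in the Cayley graph of $\mathcal S_n$ with respect to the set of all transpositions, and $\partial B(an)=\{\sigma\in\mathcal S_n:d(\sigma)=\lfloor an\rfloor\}$. $(\sigma_t)_{t\ge0}$ is the random walk on $\mathcal S_n$ started at $I$ which at rate $1$ multiplies the current permutation by a uniformly chosen transposition, and $\nu$ is the hitting distribution of $\partial B(an)$: the law of $\sigma_T$ with $T=\inf\{t>0:d(\sigma_t)=\lfloor an\rfloor\}$. *)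

theory Defs
  imports "HOL-Probability.Probability" "HOL-Combinatorics.Combinatorics"
begin

text \<open>Permutations of \<open>{1..n}\<close> are functions \<open>p\<close> with \<open>p permutes {1..n}\<close>.\<close>

definition transpositions :: "nat \<Rightarrow> (nat \<Rightarrow> nat) set" where
  "transpositions n = {Transposition.transpose i j | i j. 1 \<le> i \<and> i < j \<and> j \<le> n}"

definition cayley_edges :: "nat \<Rightarrow> ((nat \<Rightarrow> nat) \<times> (nat \<Rightarrow> nat)) set" where
  "cayley_edges n =
     {(p, p \<circ> s) | p s. p permutes {1..n} \<and> s \<in> transpositions n}"

text \<open>Only meaningful for \<open>p permutes {1..n}\<close>; otherwise no path exists.\<close>

definition cayley_dist :: "nat \<Rightarrow> (nat \<Rightarrow> nat) \<Rightarrow> nat" where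
  "cayley_dist n p = (LEAST k. (id, p) \<in> cayley_edges n ^^ k)"

definition ball_boundary :: "real \<Rightarrow> nat \<Rightarrow> (nat \<Rightarrow> nat) set" where
  "ball_boundary a n =
     {p. p permutes {1..n} \<and> int (cayley_dist n p) = \<lfloor>a * real n\<rfloor>}"

text \<open>
  A sample point \<open>\<omega>\<close> lists, for each \<open>i\<close>, the holding time \<open>fst (\<omega> i)\<close> before
  the jump number \<open>i + 1\<close> and the transposition \<open>snd (\<omega> i)\<close> used at that jump.
  All these coordinates are independent. For \<open>n < 2\<close> there is no transposition and the
  law of \<open>snd (\<omega> i)\<close> is unspecified. The completion makes functions that are
  ill-behaved only on a null set (non-positive holding times, infinitely many jumps in
  finite time, level never hit) measurable.
\<close>

definition walk_space :: "nat \<Rightarrow> (nat \<Rightarrow> real \<times> (nat \<Rightarrow> nat)) measure" where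
  "walk_space n = completion (\<Pi>\<^sub>M i\<in>UNIV.
     density lborel (\<lambda>x. ennreal (exponential_density 1 x)) \<Otimes>\<^sub>M
     measure_pmf (pmf_of_set (transpositions n)))"

definition jump_time :: "(nat \<Rightarrow> real \<times> (nat \<Rightarrow> nat)) \<Rightarrow> nat \<Rightarrow> real" where
  "jump_time \<omega> k = (\<Sum>i<k. fst (\<omega> i))"

definition num_jumps :: "(nat \<Rightarrow> real \<times> (nat \<Rightarrow> nat)) \<Rightarrow> real \<Rightarrow> nat" where
  "num_jumps \<omega> t = card {k. 1 \<le> k \<and> jump_time \<omega> k \<le> t}"

primrec jump_chain :: "(nat \<Rightarrow> real \<times> (nat \<Rightarrow> nat)) \<Rightarrow> nat \<Rightarrow> (nat \<Rightarrow> nat)" where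
  "jump_chain \<omega> 0 = id"
| "jump_chain \<omega> (Suc k) = jump_chain \<omega> k \<circ> snd (\<omega> k)"

definition walk :: "real \<Rightarrow> (nat \<Rightarrow> real \<times> (nat \<Rightarrow> nat)) \<Rightarrow> (nat \<Rightarrow> nat)" where
  "walk t \<omega> = jump_chain \<omega> (num_jumps \<omega> t)"

definition hitting_time :: "real \<Rightarrow> nat \<Rightarrow> (nat \<Rightarrow> real \<times> (nat \<Rightarrow> nat)) \<Rightarrow> real" where
  "hitting_time a n \<omega> =
     Inf {t. t > 0 \<and> int (cayley_dist n (walk t \<omega>)) = \<lfloor>a * real n\<rfloor>}"

definition hitting_distribution :: "real \<Rightarrow> nat \<Rightarrow> (nat \<Rightarrow> nat) measure" where
  "hitting_distribution a n =
     distr (walk_space n) (count_space UNIV) (\<lambda>\<omega>. walk (hitting_time a n \<omega>) \<omega>)"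

end

theory Submission
  imports Defs "HOL-Real_Asymp.Real_Asymp"
begin

text \<open>
  Let \<open>m = \<lfloor>a n\<rfloor>\<close> and \<open>c = 2 a < 1\<close>. Two counts tell the hitting distribution from the uniform
  distribution on the level: the number \<open>F\<close> of fixed points and the number \<open>Q\<close> of points in 2-cycles.

  A step of the walk that joins two cycles raises the level by one (\<open>cayley_dist_comp_transpose\<close>),
  one that splits a cycle lowers it. Read the steps as edges of a random graph on \<open>n\<close> vertices. Cycles lie
  inside components, and since about \<open>m < n / 2\<close> edges give a subcritical graph, the mean component size is
  bounded (\<open>avg_component\<close>). So the expected number of splitting steps is bounded
  (\<open>avg_num_fragmentations\<close>), and the level is hit with high probability at a time \<open>m + o(n)\<close>
  (\<open>level_hit\<close>). At time \<open>m\<close>,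
  drift equations and second moments give \<open>F \<approx> e\<^sup>-\<^sup>c n\<close> and \<open>Q \<approx> c e\<^sup>-\<^sup>2\<^sup>c n\<close>, the typical numbers of isolated
  vertices and of vertices in isolated edges of the graph; these values persist up to the hitting time.
  So the hitting distribution concentrates on the set \<open>A\<close> of permutations of level \<open>m\<close> for which \<open>F\<close>
  is near the first value and \<open>Q\<close> at most slightly above the second (\<open>typical_hit\<close>).

  On the other hand, from a permutation of level \<open>m\<close> another one is obtained by removing a moved point from its
  cycle and pairing it with a fixed point in a 2-cycle. There are \<open>F (n - F)\<close> ways to do this, and a
  permutation is obtained in at most \<open>Q n\<close> ways (\<open>switches_count\<close>). On \<open>A\<close> the ratio of the two
  numbers is not much below \<open>(e\<^sup>c - 1) / c > 1\<close> (\<open>exponent_gap\<close>), and this remains so during \<open>\<delta> n\<close> rounds of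
  such switches. The set \<open>A\<close> therefore grows to a subset of the level that is larger by an exponential
  factor (\<open>level_size_ge\<close>), and so \<open>A\<close> is an exponentially small part of the level.

  This bounds the size of \<open>A\<close> only from above. To make the limit of the logarithmic ratio exist, \<open>A\<close> is
  enlarged inside the level to a set of the prescribed size \<open>\<lceil>e\<^sup>-\<^sup>\<kappa>\<^sup>n |\<partial>B(an)|\<rceil>\<close>, and then
  \<open>\<gamma> = - \<kappa>\<close>.
\<close>

section \<open>Cycles and the Cayley distance\<close>

definition num_cycles :: "nat \<Rightarrow> (nat \<Rightarrow> nat) \<Rightarrow> nat" where
  "num_cycles n p = card (orbit p ` {1..n})"

lemma orbit_eq_of_mem:
  assumes "permutation p" "y \<in> orbit p x"
  shows "orbit p y = orbit p x"
  by (rule orbit_cyclic_eq3[OF cyclic_on_orbit'[OF assms(1)] assms(2)])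

lemma orbit_comp_transpose_other:
  assumes "permutation p" "x \<notin> orbit p z" "y \<notin> orbit p z"
  shows "orbit (p \<circ> Transposition.transpose x y) z = orbit p z"
proof (rule orbit_cong)
  show "z \<in> orbit p z" by (rule permutation_self_in_orbit[OF assms(1)])
qed (use assms in \<open>auto simp: Transposition.transpose_def\<close>)

text \<open>Started at \<open>x\<close>, the new permutation first runs through the old cycle of \<open>y\<close>, because it maps
  \<open>x\<close> to \<open>p y\<close>; when it arrives at \<open>y\<close> it continues with \<open>p x\<close> and runs through the old cycle of
  \<open>x\<close>.\<close>

lemma orbit_comp_transpose_merge:
  assumes p: "permutation p" and xy: "y \<notin> orbit p x"
  shows "orbit (p \<circ> Transposition.transpose x y) x = orbit p x \<union> orbit p y"
proof -
  define q where "q = p \<circ> Transposition.transpose x y"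
  have q: "permutation q"
    unfolding q_def by (intro permutation_compose p permutation_swap_id)
  have yx: "x \<notin> orbit p y"
    using xy orbit_eq_of_mem[OF p] permutation_self_in_orbit[OF p] by blast
  \<comment> \<open>if \<open>q\<close> enters the cycle of \<open>v\<close> from \<open>u\<close>, it runs through that whole cycle\<close>
  have half: "orbit p v \<subseteq> orbit q u"
    if uv: "q u = p v" "\<And>w. w \<in> orbit p v \<Longrightarrow> w \<noteq> v \<Longrightarrow> q w = p w" for u v
  proof
    fix w assume "w \<in> orbit p v"
    then show "w \<in> orbit q u"
    proof induction
      case base
      then show ?case using uv(1) orbit.base[of q u] by simp
    next
      case (step w)
      show ?case
      proof (cases "w = v")
        case True
        then show ?thesis using uv(1) orbit.base[of q u] by simp
      next
        case False
        then show ?thesis using uv(2)[OF step.hyps] step.IH orbit.step[of w q u] by simp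
      qed
    qed
  qed
  have y: "orbit p y \<subseteq> orbit q x"
    by (rule half) (use yx in \<open>auto simp: q_def Transposition.transpose_def\<close>)
  have x: "orbit p x \<subseteq> orbit q y"
    by (rule half) (use xy in \<open>auto simp: q_def Transposition.transpose_def\<close>)
  have "orbit q y = orbit q x"
    using y permutation_self_in_orbit[OF p] by (intro orbit_eq_of_mem q) auto
  with x y have 1: "orbit p x \<union> orbit p y \<subseteq> orbit q x" by auto
  have "w \<in> orbit p x \<union> orbit p y" if "w \<in> orbit q x" for w
    using that
  proof induction
    case base
    then show ?case using orbit.base[of p] by (auto simp: q_def)
  next
    case (step w)
    then show ?case using orbit.base[of p] orbit.step[of w p]
      by (cases "w = x"; cases "w = y") (auto simp: q_def Transposition.transpose_def)
  qed
  with 1 show ?thesis unfolding q_def by blast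
qed

text \<open>Only the cycles of \<open>x\<close> and \<open>y\<close> are touched. All other cycles survive, and the new cycle of \<open>x\<close> is
  none of them, so at most one cycle is lost. Exactly one is lost when two different cycles merge.\<close>

lemma num_cycles_comp_transpose:
  assumes p: "p permutes {1..n}" and xy: "x \<in> {1..n}" "y \<in> {1..n}"
  shows num_cycles_comp_transpose_ge:
      "num_cycles n p \<le> num_cycles n (p \<circ> Transposition.transpose x y) + 1"
    and num_cycles_comp_transpose_merge: "y \<notin> orbit p x \<Longrightarrow>
      num_cycles n p = num_cycles n (p \<circ> Transposition.transpose x y) + 1"
proof -
  define q where "q = p \<circ> Transposition.transpose x y"
  have pp: "permutation p" using p by (auto simp: permutation_permutes)
  then have qq: "permutation q"
    unfolding q_def by (intro permutation_compose permutation_swap_id)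
  let ?A = "orbit p ` {1..n} - {orbit p x, orbit p y}"
  have px: "orbit p x \<in> orbit p ` {1..n}" "orbit p y \<in> orbit p ` {1..n}" using xy by auto
  have other: "orbit q z = orbit p z" if "orbit p z \<notin> {orbit p x, orbit p y}" for z
    unfolding q_def using that orbit_eq_of_mem[OF pp, of x z] orbit_eq_of_mem[OF pp, of y z]
    by (intro orbit_comp_transpose_other pp) auto
  have notin: "orbit q x \<notin> ?A"
  proof
    assume "orbit q x \<in> ?A"
    then obtain z where "orbit q x = orbit p z" "orbit p z \<notin> {orbit p x, orbit p y}" by auto
    moreover have "x \<in> orbit q x" by (rule permutation_self_in_orbit[OF qq])
    ultimately show False using orbit_eq_of_mem[OF pp, of x z] by auto
  qed
  have sub: "insert (orbit q x) ?A \<subseteq> orbit q ` {1..n}"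
  proof -
    have "B \<in> orbit q ` {1..n}" if B: "B \<in> ?A" for B
    proof -
      obtain z where z: "z \<in> {1..n}" "B = orbit p z" using B by blast
      then have "B = orbit q z" using other[of z] B by simp
      then show ?thesis using z by blast
    qed
    then show ?thesis using xy by blast
  qed
  have "Suc (card ?A) = card (insert (orbit q x) ?A)" using notin by simp
  also have "\<dots> \<le> num_cycles n q"
    unfolding num_cycles_def by (intro card_mono sub) auto
  finally have 1: "Suc (card ?A) \<le> num_cycles n q" .
  have "card {orbit p x, orbit p y} \<le> num_cycles n p"
    unfolding num_cycles_def using px by (intro card_mono) auto
  moreover have "card ?A = num_cycles n p - card {orbit p x, orbit p y}"
    unfolding num_cycles_def using px by (intro card_Diff_subset) auto
  ultimately have 2: "card ?A + card {orbit p x, orbit p y} = num_cycles n p" by linarith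
  have "card {orbit p x, orbit p y} \<le> 2" by (cases "orbit p x = orbit p y") auto
  with 1 2 show "num_cycles n p \<le> num_cycles n (p \<circ> Transposition.transpose x y) + 1"
    unfolding q_def by linarith
  assume ne: "y \<notin> orbit p x"
  then have "orbit p x \<noteq> orbit p y" using permutation_self_in_orbit[OF pp] by blast
  then have 3: "card {orbit p x, orbit p y} = 2" by simp
  have "orbit q ` {1..n} \<subseteq> insert (orbit q x) ?A"
  proof
    fix B assume "B \<in> orbit q ` {1..n}"
    then obtain z where z: "z \<in> {1..n}" "B = orbit q z" by auto
    show "B \<in> insert (orbit q x) ?A"
    proof (cases "orbit p z \<in> {orbit p x, orbit p y}")
      case True
      then have "z \<in> orbit q x"
        using orbit_comp_transpose_merge[OF pp ne] permutation_self_in_orbit[OF pp, of z]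
        unfolding q_def by auto
      then show ?thesis using z orbit_eq_of_mem[OF qq] by auto
    qed (use z other in auto)
  qed
  with sub have "orbit q ` {1..n} = insert (orbit q x) ?A" by blast
  then have "num_cycles n q = Suc (card ?A)" unfolding num_cycles_def using notin by simp
  with 2 3 show "num_cycles n p = num_cycles n (p \<circ> Transposition.transpose x y) + 1"
    unfolding q_def by linarith
qed

lemma num_cycles_id: "num_cycles n id = n"
proof -
  have "orbit id x = {x}" for x :: nat by (simp add: orbit_eq_singleton_iff)
  then show ?thesis unfolding num_cycles_def by (simp add: card_image)
qed

lemma num_cycles_le: "num_cycles n p \<le> n"
  unfolding num_cycles_def using card_image_le[of "{1..n}" "orbit p"] by simp

lemma in_transpositionsE:
  assumes "s \<in> transpositions n"
  obtains x y where "s = Transposition.transpose x y" "x \<in> {1..n}" "y \<in> {1..n}" "x \<noteq> y"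
  using assms unfolding transpositions_def by force

lemma transpose_in_transpositions:
  assumes "x \<in> {1..n}" "y \<in> {1..n}" "x \<noteq> y"
  shows "Transposition.transpose x y \<in> transpositions n"
proof (cases "x < y")
  case False
  then have "1 \<le> y \<and> y < x \<and> x \<le> n" using assms by auto
  then show ?thesis unfolding transpositions_def by (auto simp: transpose_commute[of x y])
qed (use assms in \<open>auto simp: transpositions_def\<close>)

lemma transpositions_permutes: "s \<in> transpositions n \<Longrightarrow> s permutes {1..n}"
  by (auto elim!: in_transpositionsE intro: permutes_swap_id)

lemma cayley_path_length_ge:
  assumes "(id, p) \<in> cayley_edges n ^^ k"
  shows "p permutes {1..n} \<and> n \<le> num_cycles n p + k"
  using assms
proof (induction k arbitrary: p)
  case 0
  then have "p = id" by auto
  then show ?case using permutes_id[of "{1..n}"] by (metis add_0_right num_cycles_id order_refl)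
next
  case (Suc k)
  then obtain r s where r: "(id, r) \<in> cayley_edges n ^^ k" "p = r \<circ> s" "s \<in> transpositions n"
  proof -
    from Suc.prems obtain r where "(id, r) \<in> cayley_edges n ^^ k" "(r, p) \<in> cayley_edges n"
      by (rule relpow_Suc_E)
    moreover from this(2) obtain s where "p = r \<circ> s" "s \<in> transpositions n"
      unfolding cayley_edges_def by blast
    ultimately show thesis using that by blast
  qed
  then obtain x y where s: "s = Transposition.transpose x y" "x \<in> {1..n}" "y \<in> {1..n}"
    by (auto elim: in_transpositionsE)
  from Suc.IH[OF r(1)] have IH: "r permutes {1..n}" "n \<le> num_cycles n r + k" by auto
  then show ?case
    using num_cycles_comp_transpose_ge[OF IH(1) s(2,3)] permutes_compose[OF transpositions_permutes[OF r(3)] IH(1)]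
    unfolding r(2) s(1) by linarith
qed

text \<open>A point \<open>x\<close> that is moved by \<open>p\<close> can be used to split off its image \<open>p x\<close> as a new fixed point,
  which raises the number of cycles by one. Repeating this leads to the identity.\<close>

lemma cayley_path_exists:
  assumes "p permutes {1..n}"
  shows "(id, p) \<in> cayley_edges n ^^ (n - num_cycles n p)"
  using assms
proof (induction "card {x \<in> {1..n}. p x \<noteq> x}" arbitrary: p rule: less_induct)
  case less
  show ?case
  proof (cases "p = id")
    case True
    then show ?thesis by (simp add: num_cycles_id)
  next
    case False
    then obtain x where x: "p x \<noteq> x" by (auto simp: fun_eq_iff)
    define j q where "j = p x" and "q = p \<circ> Transposition.transpose x j"
    have inj: "inj p" using less.prems by (rule permutes_inj)
    have xj: "x \<in> {1..n}" "j \<in> {1..n}" "x \<noteq> j"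
      using x less.prems permutes_not_in[OF less.prems, of x] permutes_in_image[OF less.prems]
      by (auto simp: j_def)
    have q: "q permutes {1..n}"
      unfolding q_def using less.prems xj by (intro permutes_compose permutes_swap_id) auto
    have qj: "q j = j" by (simp add: q_def j_def)
    then have "orbit q j = {j}" by (simp add: orbit_eq_singleton_iff)
    then have sep: "x \<notin> orbit q j" using xj by simp
    have pq: "p = q \<circ> Transposition.transpose j x"
      by (simp add: q_def comp_assoc transpose_commute[of j x])
    have cyc: "num_cycles n q = num_cycles n p + 1"
      using num_cycles_comp_transpose_merge[OF q xj(2,1) sep] pq by simp
    have "{z \<in> {1..n}. q z \<noteq> z} \<subset> {z \<in> {1..n}. p z \<noteq> z}"
    proof
      show "{z \<in> {1..n}. q z \<noteq> z} \<subseteq> {z \<in> {1..n}. p z \<noteq> z}"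
      proof clarify
        fix z assume z: "q z \<noteq> z" "p z = z"
        have "z \<noteq> x" "z \<noteq> j" using z x qj by auto
        then show False using z by (simp add: q_def)
      qed
      have "p j \<noteq> j" using inj x by (simp add: j_def inj_eq)
      then show "{z \<in> {1..n}. q z \<noteq> z} \<noteq> {z \<in> {1..n}. p z \<noteq> z}" using qj xj by auto
    qed
    then have "(id, q) \<in> cayley_edges n ^^ (n - num_cycles n q)"
      by (intro less.hyps q psubset_card_mono) auto
    moreover have "(q, p) \<in> cayley_edges n"
      unfolding cayley_edges_def using q pq transpose_in_transpositions[OF xj(2,1)] xj(3) by auto
    ultimately have "(id, p) \<in> cayley_edges n ^^ Suc (n - num_cycles n q)" by auto
    moreover have "Suc (n - num_cycles n q) = n - num_cycles n p"
      using cyc num_cycles_le[of n q] by linarith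
    ultimately show ?thesis by simp
  qed
qed

lemma cayley_dist_eq:
  assumes "p permutes {1..n}"
  shows "cayley_dist n p + num_cycles n p = n"
proof -
  have "cayley_dist n p = n - num_cycles n p"
    unfolding cayley_dist_def
    by (rule Least_equality) (use cayley_path_exists[OF assms] cayley_path_length_ge in fastforce)+
  then show ?thesis using num_cycles_le[of n p] by simp
qed

text \<open>A step of the walk changes the level by at most one, and it raises the level whenever it joins
  points of different cycles.\<close>

lemma cayley_dist_comp_transpose:
  assumes p: "p permutes {1..n}" and xy: "x \<in> {1..n}" "y \<in> {1..n}"
  shows cayley_dist_comp_transpose_le: 
      "cayley_dist n (p \<circ> Transposition.transpose x y) \<le> cayley_dist n p + 1"
    and cayley_dist_comp_transpose_ge: 
      "cayley_dist n p \<le> cayley_dist n (p \<circ> Transposition.transpose x y) + 1"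
    and cayley_dist_comp_transpose_merge: "y \<notin> orbit p x \<Longrightarrow>
      cayley_dist n (p \<circ> Transposition.transpose x y) = cayley_dist n p + 1"
proof -
  let ?q = "p \<circ> Transposition.transpose x y"
  have q: "?q permutes {1..n}" using assms by (intro permutes_compose permutes_swap_id) auto
  have pq: "p = ?q \<circ> Transposition.transpose x y" by (simp add: comp_assoc)
  note d = cayley_dist_eq[OF p] cayley_dist_eq[OF q]
  show "cayley_dist n ?q \<le> cayley_dist n p + 1"
    using d num_cycles_comp_transpose_ge[OF p xy] by linarith
  have "num_cycles n ?q \<le> num_cycles n p + 1"
    using num_cycles_comp_transpose_ge[OF q xy] pq by simp
  then show "cayley_dist n p \<le> cayley_dist n ?q + 1" using d by linarith
  assume "y \<notin> orbit p x"
  then show "cayley_dist n ?q = cayley_dist n p + 1"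
    using d num_cycles_comp_transpose_merge[OF p xy] by linarith
qed

lemma cayley_dist_id: "cayley_dist n id = 0"
  using cayley_dist_eq[of id n] by (simp add: num_cycles_id)

section \<open>Fixed points, 2-cycles and switching\<close>

definition fixed_points :: "nat \<Rightarrow> (nat \<Rightarrow> nat) \<Rightarrow> nat set" where
  "fixed_points n p = {x \<in> {1..n}. p x = x}"

definition two_cycle_points :: "nat \<Rightarrow> (nat \<Rightarrow> nat) \<Rightarrow> nat set" where
  "two_cycle_points n p = {x \<in> {1..n}. p (p x) = x \<and> p x \<noteq> x}"

definition num_fixed :: "nat \<Rightarrow> (nat \<Rightarrow> nat) \<Rightarrow> real" where
  "num_fixed n p = real (card (fixed_points n p))"

definition num_two :: "nat \<Rightarrow> (nat \<Rightarrow> nat) \<Rightarrow> real" where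
  "num_two n p = real (card (two_cycle_points n p))"

lemma finite_fixed_and_two_cycle_points [simp]: "finite (fixed_points n p)" "finite (two_cycle_points n p)"
  by (auto simp: fixed_points_def two_cycle_points_def)

lemma num_fixed_bounds: "0 \<le> num_fixed n p" "num_fixed n p \<le> real n"
proof -
  have "card (fixed_points n p) \<le> card {1..n}"
    by (rule card_mono) (auto simp: fixed_points_def)
  then show "num_fixed n p \<le> real n" "0 \<le> num_fixed n p" by (auto simp: num_fixed_def)
qed

lemma num_two_bounds: "0 \<le> num_two n p" "num_two n p \<le> real n"
proof -
  have "card (two_cycle_points n p) \<le> card {1..n}"
    by (rule card_mono) (auto simp: two_cycle_points_def)
  then show "num_two n p \<le> real n" "0 \<le> num_two n p" by (auto simp: num_two_def)
qed

lemma num_fixed_sum: "num_fixed n p = (\<Sum>z\<in>{1..n}. of_bool (p z = z))"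
proof -
  have "(\<Sum>z\<in>{1..n}. of_bool (p z = z)) = real (card ({1..n} \<inter> {z. p z = z}))"
    by (rule sum_of_bool_eq) auto
  also have "{1..n} \<inter> {z. p z = z} = fixed_points n p" by (auto simp: fixed_points_def)
  finally show ?thesis by (simp add: num_fixed_def)
qed

lemma num_fixed_comp_transpose:
  assumes "x \<in> {1..n}" "y \<in> {1..n}" "x \<noteq> y"
  shows "num_fixed n (p \<circ> Transposition.transpose x y) =
    num_fixed n p - of_bool (p x = x) - of_bool (p y = y) + of_bool (p x = y) + of_bool (p y = x)"
proof -
  let ?R = "{1..n} - {x} - {y}"
  have split: "(\<Sum>z\<in>{1..n}. g z) = g x + (g y + (\<Sum>z\<in>?R. g z))" for g :: "nat \<Rightarrow> real"
  proof -
    have "(\<Sum>z\<in>{1..n}. g z) = g x + (\<Sum>z\<in>{1..n} - {x}. g z)"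
      using assms by (intro sum.remove) auto
    also have "(\<Sum>z\<in>{1..n} - {x}. g z) = g y + (\<Sum>z\<in>?R. g z)"
      using assms by (intro sum.remove) auto
    finally show ?thesis .
  qed
  have "(\<Sum>z\<in>?R. of_bool ((p \<circ> Transposition.transpose x y) z = z) :: real) =
      (\<Sum>z\<in>?R. of_bool (p z = z))"
    by (intro sum.cong) auto
  then show ?thesis unfolding num_fixed_sum split by simp
qed

lemma num_fixed_comp_transpose_diff:
  assumes "x \<in> {1..n}" "y \<in> {1..n}" "x \<noteq> y"
  shows "\<bar>num_fixed n (p \<circ> Transposition.transpose x y) - num_fixed n p\<bar> \<le> 2"
  unfolding num_fixed_comp_transpose[OF assms] by (auto simp: of_bool_def)

lemma num_two_comp_transpose_le:
  assumes p: "p permutes {1..n}"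
  shows "num_two n (p \<circ> Transposition.transpose x y) \<le> num_two n p + 4"
proof -
  let ?q = "p \<circ> Transposition.transpose x y"
  let ?E = "{x, y, inv p x, inv p y}"
  have "two_cycle_points n ?q \<subseteq> two_cycle_points n p \<union> ?E"
  proof
    fix z assume z: "z \<in> two_cycle_points n ?q"
    show "z \<in> two_cycle_points n p \<union> ?E"
    proof (cases "z \<in> ?E")
      case False
      then have "z \<noteq> x" "z \<noteq> y" "p z \<noteq> x" "p z \<noteq> y"
        using permutes_inverses(2)[OF p] by auto
      then show ?thesis using z by (auto simp: two_cycle_points_def)
    qed auto
  qed
  then have "card (two_cycle_points n ?q) \<le> card (two_cycle_points n p \<union> ?E)"
    by (intro card_mono) auto
  also have "\<dots> \<le> card (two_cycle_points n p) + card ?E" by (rule card_Un_le)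
  also have "card ?E \<le> 4"
    using card_length[of "[x, y, inv p x, inv p y]"] by simp
  finally show ?thesis by (simp add: num_two_def)
qed

lemma num_two_comp_transpose_diff:
  assumes p: "p permutes {1..n}" and "x \<in> {1..n}" "y \<in> {1..n}"
  shows "\<bar>num_two n (p \<circ> Transposition.transpose x y) - num_two n p\<bar> \<le> 4"
proof -
  let ?q = "p \<circ> Transposition.transpose x y"
  have "?q permutes {1..n}" using assms by (intro permutes_compose permutes_swap_id) auto
  from num_two_comp_transpose_le[OF this, of x y] num_two_comp_transpose_le[OF p, of x y]
  show ?thesis by (simp add: comp_assoc)
qed

text \<open>For a fixed point \<open>i\<close> and a moved point \<open>x\<close>, the first transposition removes \<open>p x\<close> from its cycle,
  the second one pairs \<open>p x\<close> with \<open>i\<close> in a 2-cycle. A split followed by a merge keeps the level. The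
  pair \<open>(i, x)\<close> and the result determine \<open>p\<close>, since \<open>p x\<close> is the new partner of \<open>i\<close>.\<close>

definition switch :: "nat \<Rightarrow> nat \<Rightarrow> (nat \<Rightarrow> nat) \<Rightarrow> nat \<Rightarrow> nat" where
  "switch i x p = p \<circ> Transposition.transpose x (p x) \<circ> Transposition.transpose i (p x)"

lemma switch:
  assumes p: "p permutes {1..n}" and i: "i \<in> {1..n}" "p i = i" and x: "x \<in> {1..n}" "p x \<noteq> x"
  shows switch_permutes: "switch i x p permutes {1..n}"
    and switch_dist: "cayley_dist n (switch i x p) = cayley_dist n p"
    and switch_num_fixed: "\<bar>num_fixed n (switch i x p) - num_fixed n p\<bar> \<le> 4"
    and switch_num_two: "\<bar>num_two n (switch i x p) - num_two n p\<bar> \<le> 8"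
    and switch_mem: "i \<in> two_cycle_points n (switch i x p)"
    and switch_inverse: "p = switch i x p \<circ> Transposition.transpose i (switch i x p i)
            \<circ> Transposition.transpose x (switch i x p i)"
proof -
  define j q where "j = p x" and "q = p \<circ> Transposition.transpose x j"
  have s: "switch i x p = q \<circ> Transposition.transpose i j" by (simp add: switch_def q_def j_def)
  have inj: "inj p" using p by (rule permutes_inj)
  have j: "j \<in> {1..n}" "x \<noteq> j" "i \<noteq> x" 
    using x i permutes_in_image[OF p] by (auto simp: j_def)
  have ij: "i \<noteq> j" using inj i j(3) by (auto simp: j_def dest: injD[of p i x])
  have q: "q permutes {1..n}"
    unfolding q_def using p x j by (intro permutes_compose permutes_swap_id) auto
  show "switch i x p permutes {1..n}"
    unfolding s using q i j by (intro permutes_compose permutes_swap_id) auto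
  have qj: "q j = j" "q i = i" using i j ij by (simp_all add: q_def j_def)
  have "orbit q j = {j}" using qj by (simp add: orbit_eq_singleton_iff)
  then have o: "x \<notin> orbit q j" "i \<notin> orbit q j" using j ij by auto
  have pq: "p = q \<circ> Transposition.transpose j x"
    by (simp add: q_def comp_assoc transpose_commute[of j x])
  have "cayley_dist n p = cayley_dist n q + 1"
    using cayley_dist_comp_transpose_merge[OF q j(1) x(1) o(1)] pq by simp
  moreover have "cayley_dist n (q \<circ> Transposition.transpose j i) = cayley_dist n q + 1"
    by (rule cayley_dist_comp_transpose_merge[OF q j(1) i(1) o(2)])
  ultimately show "cayley_dist n (switch i x p) = cayley_dist n p"
    unfolding s by (simp add: transpose_commute[of i j])
  show "\<bar>num_fixed n (switch i x p) - num_fixed n p\<bar> \<le> 4"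
    unfolding s using num_fixed_comp_transpose_diff[OF x(1) j(1,2), of p]
      num_fixed_comp_transpose_diff[OF i(1) j(1) ij, of q] unfolding q_def[symmetric] by linarith
  show "\<bar>num_two n (switch i x p) - num_two n p\<bar> \<le> 8"
    unfolding s using num_two_comp_transpose_diff[OF p x(1) j(1)]
      num_two_comp_transpose_diff[OF q i(1) j(1)] unfolding q_def[symmetric] by linarith
  have si: "switch i x p i = j" "switch i x p j = i" unfolding s using qj by simp_all
  show "i \<in> two_cycle_points n (switch i x p)"
    using si i ij by (simp add: two_cycle_points_def)
  show "p = switch i x p \<circ> Transposition.transpose i (switch i x p i)
            \<circ> Transposition.transpose x (switch i x p i)"
    unfolding si unfolding s by (simp add: q_def comp_assoc)
qed

definition switches :: "nat \<Rightarrow> (nat \<Rightarrow> nat) set \<Rightarrow> (nat \<Rightarrow> nat) set" where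
  "switches n U = (\<Union>p\<in>U. \<Union>i\<in>fixed_points n p. \<Union>x\<in>{1..n} - fixed_points n p. {switch i x p})"

text \<open>Double counting of switches: \<open>p\<close> can be switched in \<open>F (n - F)\<close> ways, where \<open>F\<close> is its number of
  fixed points. A given result arises from at most \<open>Q n\<close> switches, where \<open>Q\<close> is its number of points
  in 2-cycles, because \<open>i\<close> is such a point and \<open>x\<close> is one of \<open>n\<close> points.\<close>

lemma switches_count:
  assumes U: "finite U" "\<And>p. p \<in> U \<Longrightarrow> p permutes {1..n}"
  shows "(\<Sum>p\<in>U. num_fixed n p * (real n - num_fixed n p)) \<le>
    (\<Sum>p\<in>switches n U. num_two n p * real n)"
proof -
  let ?A = "Sigma U (\<lambda>p. fixed_points n p \<times> ({1..n} - fixed_points n p))"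
  let ?B = "Sigma (switches n U) (\<lambda>p. two_cycle_points n p \<times> {1..n})"
  let ?f = "\<lambda>(p, i, x). (switch i x p, i, x)"
  have fin: "finite (switches n U)" using U(1) by (auto simp: switches_def)
  have A: "p permutes {1..n}" "i \<in> {1..n}" "p i = i" "x \<in> {1..n}" "p x \<noteq> x"
    if "(p, i, x) \<in> ?A" for p i x
    using that U(2) by (auto simp: fixed_points_def)
  have inj: "inj_on ?f ?A"
  proof (rule inj_onI)
    fix u v assume uv: "u \<in> ?A" "v \<in> ?A" "?f u = ?f v"
    obtain p i x p' where u: "u = (p, i, x)" "v = (p', i, x)" "switch i x p = switch i x p'"
      using uv(3) by (cases u; cases v) auto
    have "p = switch i x p \<circ> Transposition.transpose i (switch i x p i)
            \<circ> Transposition.transpose x (switch i x p i)"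
      by (rule switch_inverse[OF A]) (use uv u in auto)
    moreover have "p' = switch i x p' \<circ> Transposition.transpose i (switch i x p' i)
            \<circ> Transposition.transpose x (switch i x p' i)"
      by (rule switch_inverse[OF A]) (use uv u in auto)
    ultimately show "u = v" using u by simp
  qed
  have "?f ` ?A \<subseteq> ?B"
  proof clarify
    fix p i x assume *: "p \<in> U" "i \<in> fixed_points n p" "x \<in> {1..n}" "x \<notin> fixed_points n p"
    then have "switch i x p \<in> switches n U" unfolding switches_def by blast
    moreover have "i \<in> two_cycle_points n (switch i x p)"
      by (rule switch_mem[OF A]) (use * in auto)
    ultimately show "switch i x p \<in> switches n U \<and> (i, x) \<in> two_cycle_points n (switch i x p) \<times> {1..n}"
      using *(3) by simp
  qed
  then have le: "card ?A \<le> card ?B"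
    by (intro card_inj_on_le[OF inj] finite_SigmaI fin) auto
  have cardF: "real (card ({1..n} - fixed_points n p)) = real n - num_fixed n p" for p
  proof -
    have "fixed_points n p \<subseteq> {1..n}" by (auto simp: fixed_points_def)
    then show ?thesis using card_mono[of "{1..n}" "fixed_points n p"]
      by (simp add: card_Diff_subset num_fixed_def of_nat_diff)
  qed
  have "real (card ?A) = (\<Sum>p\<in>U. num_fixed n p * (real n - num_fixed n p))"
    using U(1) by (subst card_SigmaI) (auto simp: card_cartesian_product cardF[simplified] num_fixed_def[symmetric])
  moreover have "real (card ?B) = (\<Sum>p\<in>switches n U. num_two n p * real n)"
    using fin by (subst card_SigmaI) (auto simp: card_cartesian_product num_two_def)
  moreover have "real (card ?A) \<le> real (card ?B)" by (rule of_nat_mono[OF le])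
  ultimately show ?thesis by linarith
qed

text \<open>As long as \<open>F / n\<close> is near \<open>\<phi>\<close> and \<open>Q / n\<close> is not much larger than \<open>\<psi>\<close>, a round of switching
  multiplies the size of a set of permutations by at least
  \<open>(\<phi> (1 - \<phi>) - 5 \<delta>) / (\<psi> + 9 \<delta>) \<ge> r\<close>. A round changes \<open>F\<close> by at most 4 and \<open>Q\<close> by at most 8,
  so \<open>\<delta> n\<close> rounds are possible before the two densities have drifted by more than a multiple of
  \<open>\<delta>\<close>. This is the source of the exponential factor in the theorem.\<close>

lemma level_size_ge:
  fixes \<phi> \<psi> \<delta> r :: real
  assumes n: "n \<ge> 1" and U: "\<And>p. p \<in> U \<Longrightarrow> p permutes {1..n} \<and> cayley_dist n p = m \<and>
      \<bar>num_fixed n p - \<phi> * n\<bar> \<le> \<delta> * n \<and> num_two n p \<le> (\<psi> + \<delta>) * n"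
    and \<phi>: "0 \<le> \<phi>" "\<phi> \<le> 1" and \<psi>: "0 \<le> \<psi>" and \<delta>: "0 < \<delta>"
    and r: "0 \<le> r" "r * (\<psi> + 9 * \<delta>) \<le> \<phi> * (1 - \<phi>) - 5 * \<delta>"
    and L: "real L \<le> \<delta> * n"
  shows "r ^ L * card U \<le> card {p. p permutes {1..n} \<and> cayley_dist n p = m}"
proof -
  let ?P = "{p. p permutes {1..n}}"
  define W where "W i = (switches n ^^ i) U" for i
  have finP: "finite ?P" by (rule finite_permutations) simp
  have W: "p permutes {1..n} \<and> cayley_dist n p = m \<and>
      \<bar>num_fixed n p - \<phi> * n\<bar> \<le> \<delta> * n + 4 * i \<and> num_two n p \<le> (\<psi> + \<delta>) * n + 8 * i"
    if "p \<in> W i" for p i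
    using that
  proof (induction i arbitrary: p)
    case 0
    then show ?case using U by (simp add: W_def)
  next
    case (Suc i)
    from Suc.prems obtain p' j x where p': "p' \<in> W i" "j \<in> {1..n}" "p' j = j"
       "x \<in> {1..n}" "p' x \<noteq> x" "p = switch j x p'"
        unfolding W_def switches_def fixed_points_def funpow.simps comp_apply by blast
    note IH = Suc.IH[OF p'(1)]
    then have perm: "p' permutes {1..n}" by simp
    note sw = switch[OF perm p'(2-5), folded p'(6)]
    show ?case using IH sw(1-4) by (simp add: algebra_simps) linarith
  qed
  have finW: "finite (W i)" for i
    by (rule finite_subset[OF _ finP]) (use W in auto)
  have step: "r * card (W i) \<le> card (W (Suc i))" if i: "i < L" for i
  proof -
    have "real (Suc i) \<le> real L" using i by linarith
    then have iL: "real i + 1 \<le> \<delta> * n" using L by simp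
    let ?c = "\<phi> * (1 - \<phi>) - 5 * \<delta>"
    have lower: "?c * (real n)\<^sup>2 \<le> num_fixed n p * (real n - num_fixed n p)" if p: "p \<in> W i" for p
    proof -
      define t where "t = num_fixed n p / n"
      have t: "num_fixed n p = t * n" using n by (simp add: t_def)
      have t01: "0 \<le> t" "t \<le> 1" using num_fixed_bounds[of n p] n by (auto simp: t_def)
      have "\<bar>t - \<phi>\<bar> * n = \<bar>num_fixed n p - \<phi> * n\<bar>"
        unfolding t by (simp add: abs_mult flip: left_diff_distrib)
      also have "\<dots> \<le> 5 * \<delta> * n" using W[OF p] iL by linarith
      finally have "\<bar>t - \<phi>\<bar> \<le> 5 * \<delta>" using n by simp
      moreover have "\<bar>(t - \<phi>) * (1 - t - \<phi>)\<bar> \<le> \<bar>t - \<phi>\<bar> * 1"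
        unfolding abs_mult using t01 \<phi> by (intro mult_left_mono) auto
      moreover have "(t - \<phi>) * (1 - t - \<phi>) = t * (1 - t) - \<phi> * (1 - \<phi>)"
        by (simp add: algebra_simps)
      ultimately have "\<bar>t * (1 - t) - \<phi> * (1 - \<phi>)\<bar> \<le> 5 * \<delta>" by simp
      then have "?c \<le> t * (1 - t)" by linarith
      then have "?c * (real n)\<^sup>2 \<le> (t * (1 - t)) * (real n)\<^sup>2" by (intro mult_right_mono) auto
      then show ?thesis unfolding t by (simp add: power2_eq_square algebra_simps)
    qed
    have upper: "num_two n p * n \<le> (\<psi> + 9 * \<delta>) * (real n)\<^sup>2" if p: "p \<in> W (Suc i)" for p
    proof -
      have "num_two n p \<le> (\<psi> + 9 * \<delta>) * n"
        using W[OF p] iL by (simp add: algebra_simps)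
      then have "num_two n p * n \<le> (\<psi> + 9 * \<delta>) * n * n" by (intro mult_right_mono) auto
      then show ?thesis by (simp add: power2_eq_square algebra_simps)
    qed
    have "r * (\<psi> + 9 * \<delta>) * (real n)\<^sup>2 * card (W i) \<le> ?c * (real n)\<^sup>2 * card (W i)"
      using r by (intro mult_right_mono) auto
    also have "\<dots> = (\<Sum>p\<in>W i. ?c * (real n)\<^sup>2)" by simp
    also have "\<dots> \<le> (\<Sum>p\<in>W i. num_fixed n p * (real n - num_fixed n p))"
      by (rule sum_mono[OF lower])
    also have "\<dots> \<le> (\<Sum>p\<in>switches n (W i). num_two n p * real n)"
      by (rule switches_count[OF finW]) (use W in auto)
    also have "switches n (W i) = W (Suc i)" by (simp add: W_def)
    also have "(\<Sum>p\<in>W (Suc i). num_two n p * real n) \<le> (\<Sum>p\<in>W (Suc i). (\<psi> + 9 * \<delta>) * (real n)\<^sup>2)"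
      by (rule sum_mono[OF upper])
    finally have "(r * card (W i)) * ((\<psi> + 9 * \<delta>) * (real n)\<^sup>2) \<le>
        card (W (Suc i)) * ((\<psi> + 9 * \<delta>) * (real n)\<^sup>2)"
      by (simp add: algebra_simps)
    moreover have "0 < (\<psi> + 9 * \<delta>) * (real n)\<^sup>2" using \<psi> \<delta> n by (intro mult_pos_pos) auto
    ultimately show ?thesis by (rule mult_right_le_imp_le)
  qed
  have "r ^ i * card U \<le> card (W i)" if "i \<le> L" for i
    using that
  proof (induction i)
    case 0
    then show ?case by (simp add: W_def)
  next
    case (Suc i)
    then have "r * (r ^ i * card U) \<le> r * card (W i)" using r(1) by (intro mult_left_mono) auto
    also have "\<dots> \<le> card (W (Suc i))" using Suc.prems by (intro step) simp
    finally show ?case by (simp add: mult.assoc)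
  qed
  from this[of L] have "r ^ L * card U \<le> card (W L)" by simp
  also have "card (W L) \<le> card {p. p permutes {1..n} \<and> cayley_dist n p = m}"
    by (rule card_mono) (use W finite_subset[OF _ finP] in auto)
  finally show ?thesis by simp
qed

section \<open>Uniform sequences of transpositions\<close>

text \<open>The expectation of \<open>h\<close> when the entries with index in \<open>I\<close> are independent and uniform on \<open>T\<close>.\<close>

definition avg :: "'a set \<Rightarrow> 'i set \<Rightarrow> (('i \<Rightarrow> 'a) \<Rightarrow> real) \<Rightarrow> real" where
  "avg T I h = (\<Sum>s\<in>I \<rightarrow>\<^sub>E T. h s) / real (card T) ^ card I"

lemma avg_mono:
  "(\<And>s. s \<in> I \<rightarrow>\<^sub>E T \<Longrightarrow> h s \<le> g s) \<Longrightarrow> avg T I h \<le> avg T I g"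
  unfolding avg_def by (intro divide_right_mono sum_mono) auto

lemma avg_add: "avg T I (\<lambda>s. h s + g s) = avg T I h + avg T I g"
  by (simp add: avg_def sum.distrib add_divide_distrib)

lemma avg_cmult: "avg T I (\<lambda>s. c * h s) = c * avg T I h"
  by (simp add: avg_def sum_distrib_left[symmetric])

lemma avg_sum: "avg T I (\<lambda>s. \<Sum>j\<in>J. h j s) = (\<Sum>j\<in>J. avg T I (h j))"
  unfolding avg_def by (subst sum.swap) (simp add: sum_divide_distrib)

lemma avg_const:
  assumes "finite T" "T \<noteq> {}" "finite I"
  shows "avg T I (\<lambda>_. c) = c"
  using assms by (simp add: avg_def card_PiE)

text \<open>Conditioning on all coordinates except \<open>t\<close>.\<close>

lemma avg_insert:
  assumes "finite I" "t \<notin> I"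
  shows "avg T (insert t I) h = avg T I (\<lambda>s. (\<Sum>\<tau>\<in>T. h (s(t := \<tau>))) / real (card T))"
proof -
  have "(\<Sum>s\<in>insert t I \<rightarrow>\<^sub>E T. h s) = (\<Sum>(\<tau>, s)\<in>T \<times> (I \<rightarrow>\<^sub>E T). h (s(t := \<tau>)))"
    using inj_combinator[OF assms(2), of "\<lambda>_. T"]
    by (subst PiE_insert_eq, subst sum.reindex) (auto intro!: sum.cong)
  also have "\<dots> = (\<Sum>s\<in>I \<rightarrow>\<^sub>E T. \<Sum>\<tau>\<in>T. h (s(t := \<tau>)))"
    by (subst sum.swap) (simp add: sum.cartesian_product)
  finally show ?thesis
    using assms by (simp add: avg_def sum_divide_distrib mult.commute)
qed

lemma avg_insert_indep:
  assumes "finite T" "T \<noteq> {}" "finite I" "t \<notin> I" "\<And>s \<tau>. h (s(t := \<tau>)) = h s"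
  shows "avg T (insert t I) h = avg T I h"
  using assms by (simp add: avg_insert)

lemma avg_lessThan_mono:
  fixes k K :: nat
  assumes "finite T" "T \<noteq> {}" "k \<le> K" "\<And>s t \<tau>. k \<le> t \<Longrightarrow> h (s(t := \<tau>)) = h s"
  shows "avg T {..<K} h = avg T {..<k} h"
  using assms(3)
proof (induction K rule: dec_induct)
  case (step i)
  have "avg T (insert i {..<i}) h = avg T {..<i} h"
    using assms step by (intro avg_insert_indep) auto
  then show ?case using step by (simp add: lessThan_Suc)
qed simp

lemma sum_ordered_pairs:
  fixes h :: "(nat \<Rightarrow> nat) \<Rightarrow> real"
  shows "(\<Sum>x\<in>{1..n}. \<Sum>y\<in>{1..n} - {x}. h (Transposition.transpose x y)) =
    2 * (\<Sum>\<tau>\<in>transpositions n. h \<tau>)"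
proof -
  let ?L = "{(i, j). 1 \<le> i \<and> i < j \<and> j \<le> n}" and ?G = "{(i, j). 1 \<le> j \<and> j < i \<and> i \<le> n}"
  let ?f = "\<lambda>(i, j). Transposition.transpose i j :: nat \<Rightarrow> nat"
  have fin: "finite ?L" "finite ?G"
    by (rule finite_subset[of _ "{1..n} \<times> {1..n}"]; auto)+
  have inj: "inj_on ?f ?L"
  proof (rule inj_onI, clarify)
    fix i j i' j' :: nat
    assume a: "Transposition.transpose i j = Transposition.transpose i' j'" "i < j" "i' < j'"
    have "(Transposition.transpose i' j' i \<noteq> i) \<and> Transposition.transpose i' j' i = j"
      using fun_cong[OF a(1), of i] a(2) by simp
    with a(2,3) show "i = i' \<and> j = j'"
      by (auto simp: Transposition.transpose_def split: if_splits)
  qed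
  have T: "transpositions n = ?f ` ?L" by (auto simp: transpositions_def)
  have "(\<Sum>p\<in>?G. h (?f p)) = (\<Sum>p\<in>?L. h (?f p))"
    by (rule sum.reindex_bij_witness[where i = prod.swap and j = prod.swap])
       (auto simp: transpose_commute)
  moreover have "(\<Sum>p\<in>?L. h (?f p)) = (\<Sum>\<tau>\<in>transpositions n. h \<tau>)"
    unfolding T by (subst sum.reindex[OF inj]) simp
  moreover have "(\<Sum>x\<in>{1..n}. \<Sum>y\<in>{1..n} - {x}. h (Transposition.transpose x y)) =
      (\<Sum>p\<in>?L \<union> ?G. h (?f p))"
    by (subst sum.Sigma) (auto intro!: sum.cong)
  moreover have "\<dots> = (\<Sum>p\<in>?L. h (?f p)) + (\<Sum>p\<in>?G. h (?f p))"
    by (rule sum.union_disjoint[OF fin]) auto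
  ultimately show ?thesis by simp
qed

lemma finite_transpositions: "finite (transpositions n)"
  by (rule finite_subset[OF _ finite_permutations[of "{1..n}"]])
     (use transpositions_permutes in blast, simp)

lemma card_transpositions: "2 * real (card (transpositions n)) = real n * (real n - 1)"
proof -
  have "2 * real (card (transpositions n)) = (\<Sum>x\<in>{1..n}. \<Sum>y\<in>{1..n} - {x}. 1)"
    by (subst sum_ordered_pairs) simp
  also have "\<dots> = (\<Sum>x\<in>{1..n}. real n - 1)"
    by (intro sum.cong) (auto simp: of_nat_diff)
  finally show ?thesis by simp
qed

lemma transpositions_nonempty: "n \<ge> 2 \<Longrightarrow> transpositions n \<noteq> {}"
  using card_transpositions[of n] by auto

lemma avg_transposition:
  fixes h :: "(nat \<Rightarrow> nat) \<Rightarrow> real"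
  shows "(\<Sum>\<tau>\<in>transpositions n. h \<tau>) / real (card (transpositions n)) =
    (\<Sum>x\<in>{1..n}. \<Sum>y\<in>{1..n} - {x}. h (Transposition.transpose x y)) / (real n * (real n - 1))"
  unfolding sum_ordered_pairs card_transpositions[symmetric] by simp

section \<open>Components of the transposition graph\<close>

definition component :: "nat set \<Rightarrow> (nat \<Rightarrow> nat \<Rightarrow> nat) \<Rightarrow> nat \<Rightarrow> nat set" where
  "component I s x = {y. (x, y) \<in> {(u, s t u) | t u. t \<in> I}\<^sup>*}"

lemma component_refl: "x \<in> component I s x"
  by (simp add: component_def)

lemma component_step: "y \<in> component I s x \<Longrightarrow> t \<in> I \<Longrightarrow> s t y \<in> component I s x"
  unfolding component_def by (auto intro: rtrancl.rtrancl_into_rtrancl)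

lemma component_induct [consumes 1, case_names refl step]:
  assumes "y \<in> component I s x" "P x"
    "\<And>y t. y \<in> component I s x \<Longrightarrow> t \<in> I \<Longrightarrow> P y \<Longrightarrow> P (s t y)"
  shows "P y"
  using assms(1) unfolding component_def mem_Collect_eq
proof (induction rule: rtrancl_induct)
  case (step y z)
  then show ?case using assms(3)[unfolded component_def] by auto
qed (rule assms(2))

lemma component_subset:
  assumes "\<And>t. t \<in> I \<Longrightarrow> s t \<in> transpositions n" "x \<in> {1..n}"
  shows "component I s x \<subseteq> {1..n}"
proof
  fix y assume "y \<in> component I s x"
  then show "y \<in> {1..n}"
  proof (induction rule: component_induct)
    case (step y t)
    then show ?case using permutes_in_image[OF transpositions_permutes[OF assms(1)]] by blast
  qed (rule assms)
qed

text \<open>A path from \<open>x\<close> to another vertex can be started at its last visit to \<open>x\<close>. After that it never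
  uses its first edge again, as this edge contains \<open>x\<close>, so the rest of the path lives in the graph
  without that edge.\<close>

lemma component_decompose:
  assumes s: "\<And>t. t \<in> I \<Longrightarrow> s t \<in> transpositions n"
  shows "component I s x \<subseteq>
    insert x (\<Union>t\<in>{t \<in> I. s t x \<noteq> x}. component (I - {t}) s (s t x))"
proof
  fix y assume "y \<in> component I s x"
  then show "y \<in> insert x (\<Union>t\<in>{t \<in> I. s t x \<noteq> x}. component (I - {t}) s (s t x))"
  proof (induction rule: component_induct)
    case refl
    then show ?case by simp
  next
    case (step y t)
    have new: "s t x \<in> component (I - {t}) s (s t x)" by (rule component_refl)
    \<comment> \<open>the new edge either avoids \<open>x\<close> or can only lead back to \<open>x\<close> or to its other endpoint\<close>
    from step.IH consider "y = x"
      | r where "r \<in> I" "s r x \<noteq> x" "y \<in> component (I - {r}) s (s r x)" by auto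
    then show ?case
    proof cases
      case 1
      then show ?thesis using new step.hyps(2) by (cases "s t x = x") auto
    next
      case 2
      show ?thesis
      proof (cases "t = r")
        case False
        then have "s t y \<in> component (I - {r}) s (s r x)"
          using 2 step.hyps(2) by (intro component_step) auto
        then show ?thesis using 2 by blast
      next
        case True
        obtain u v where uv: "s t = Transposition.transpose u v"
          using in_transpositionsE[OF s[OF step.hyps(2)]] by metis
        then have "s t y = y \<or> s t y = x \<or> s t y = s t x"
          using 2(2) True by (auto simp: Transposition.transpose_def split: if_splits)
        then show ?thesis using 2 True new step.hyps(2) by auto
      qed
    qed
  qed
qed

lemma component_cong:
  assumes "\<And>t. t \<in> I \<Longrightarrow> s t = s' t"
  shows "component I s x = component I s' x"
proof -
  have "{(u, s t u) | t u. t \<in> I} = {(u, s' t u) | t u. t \<in> I}"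
    using assms by (intro Collect_cong) metis
  then show ?thesis by (simp add: component_def)
qed

lemma card_moving_transpositions:
  assumes "x \<in> {1..n}"
  shows "card {\<tau> \<in> transpositions n. \<tau> x \<noteq> x} \<le> n - 1"
proof -
  have "{\<tau> \<in> transpositions n. \<tau> x \<noteq> x} \<subseteq> Transposition.transpose x ` ({1..n} - {x})"
  proof clarify
    fix \<tau> assume \<tau>: "\<tau> \<in> transpositions n" "\<tau> x \<noteq> x"
    then obtain u v where uv: "\<tau> = Transposition.transpose u v" "u \<in> {1..n}" "v \<in> {1..n}" "u \<noteq> v"
      by (auto elim: in_transpositionsE)
    with \<tau>(2) consider "x = u" | "x = v" by (auto simp: Transposition.transpose_def split: if_splits)
    then show "\<tau> \<in> Transposition.transpose x ` ({1..n} - {x})"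
      using uv by cases (auto simp: transpose_commute)
  qed
  then have "card {\<tau> \<in> transpositions n. \<tau> x \<noteq> x} \<le> card (Transposition.transpose x ` ({1..n} - {x}))"
    by (intro card_mono) auto
  also have "\<dots> \<le> card ({1..n} - {x})" by (rule card_image_le) simp
  also have "\<dots> = n - 1" using assms by simp
  finally show ?thesis .
qed

text \<open>By the decomposition, the mean component size \<open>B\<^sub>j\<close> with \<open>j\<close> edges satisfies
  \<open>B\<^sub>j \<le> 1 + j (2 / n) B\<^sub>j\<^sub>-\<^sub>1\<close>: an edge contains \<open>x\<close> with probability \<open>2 / n\<close> and is independent
  of the other edges. With \<open>K\<close> edges and \<open>q = 2 K / n < 1\<close> the mean is therefore at most
  \<open>1 / (1 - q)\<close>; here \<open>a < 1 / 2\<close> enters.\<close>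

lemma avg_component:
  fixes B :: real
  assumes n: "n \<ge> 2" and B: "1 + 2 * real K / real n * B \<le> B" and B0: "0 \<le> B"
    and I: "finite I" "card I \<le> K" and x: "x \<in> {1..n}"
  shows "avg (transpositions n) I (\<lambda>s. card (component I s x)) \<le> B"
  using I x
proof (induction "card I" arbitrary: I x rule: less_induct)
  case (less I x)
  let ?T = "transpositions n"
  note T = finite_transpositions[of n] transpositions_nonempty[OF n]
  let ?N = "real (card ?T)"
  have N: "?N > 0" using T by (simp add: card_gt_0_iff)
  have pt: "real (card (component I s x)) \<le>
      1 + (\<Sum>t\<in>I. of_bool (s t x \<noteq> x) * real (card (component (I - {t}) s (s t x))))"
    if s: "s \<in> I \<rightarrow>\<^sub>E ?T" for s
  proof -
    let ?J = "{t \<in> I. s t x \<noteq> x}"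
    have st: "s t \<in> ?T" if "t \<in> I" for t using s that by auto
    have fin: "finite (component (I - {t}) s (s t x))" if "t \<in> I" for t
      using permutes_in_image[OF transpositions_permutes[OF st[OF that]]] less.prems
      by (intro finite_subset[OF component_subset[of _ s n]] st) auto
    have "card (component I s x) \<le> card (insert x (\<Union>t\<in>?J. component (I - {t}) s (s t x)))"
      using component_decompose[OF st] fin less.prems by (intro card_mono) auto
    also have "\<dots> \<le> 1 + card (\<Union>t\<in>?J. component (I - {t}) s (s t x))"
      using card_insert_le_m1[of 1] by (simp add: card_insert_if fin less.prems)
    also have "card (\<Union>t\<in>?J. component (I - {t}) s (s t x)) \<le>
        (\<Sum>t\<in>?J. card (component (I - {t}) s (s t x)))"
      using less.prems by (intro card_UN_le) auto
    also have "(\<Sum>t\<in>?J. card (component (I - {t}) s (s t x))) =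
        (\<Sum>t\<in>I. of_bool (s t x \<noteq> x) * card (component (I - {t}) s (s t x)))"
      using less.prems by (simp add: sum.inter_filter of_bool_def) (intro sum.cong refl, simp)
    finally have "card (component I s x) \<le>
        1 + (\<Sum>t\<in>I. of_bool (s t x \<noteq> x) * card (component (I - {t}) s (s t x)))"
      by simp
    then have "real (card (component I s x)) \<le>
        real (1 + (\<Sum>t\<in>I. of_bool (s t x \<noteq> x) * card (component (I - {t}) s (s t x))))"
      by (rule of_nat_mono)
    then show ?thesis by (simp only: of_nat_add of_nat_1 of_nat_sum of_nat_mult of_nat_of_bool)
  qed
  have branch: "avg ?T I (\<lambda>s. of_bool (s t x \<noteq> x) * real (card (component (I - {t}) s (s t x)))) \<le> 2 / real n * B"
    if t: "t \<in> I" for t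
  proof -
    define J where "J = I - {t}"
    have J: "I = insert t J" "t \<notin> J" "finite J" "card J < card I"
      using t less.prems card_Diff1_less[OF less.prems(1) t] by (auto simp: J_def)
    have comp: "component J (s(t := \<tau>)) z = component J s z" for s \<tau> z
      using J by (intro component_cong) auto
    have IH: "avg ?T J (\<lambda>s. card (component J s (\<tau> x))) \<le> B" if "\<tau> \<in> ?T" for \<tau>
      using J less.prems permutes_in_image[OF transpositions_permutes[OF that]]
      by (intro less.hyps) auto
    have "avg ?T I (\<lambda>s. of_bool (s t x \<noteq> x) * real (card (component J s (s t x)))) =
        avg ?T J (\<lambda>s. (\<Sum>\<tau>\<in>?T. of_bool (\<tau> x \<noteq> x) * real (card (component J s (\<tau> x)))) / ?N)"
      unfolding J(1) by (subst avg_insert[OF J(3,2)]) (simp add: comp)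
    also have "\<dots> = (\<Sum>\<tau>\<in>?T. of_bool (\<tau> x \<noteq> x) * avg ?T J (\<lambda>s. real (card (component J s (\<tau> x))))) / ?N"
      using avg_cmult[of ?T J "1 / ?N"] by (simp add: avg_sum avg_cmult)
    also have "\<dots> \<le> (\<Sum>\<tau>\<in>?T. of_bool (\<tau> x \<noteq> x) * B) / ?N"
      by (intro divide_right_mono sum_mono mult_left_mono IH) auto
    also have "(\<Sum>\<tau>\<in>?T. of_bool (\<tau> x \<noteq> x) * B) = card {\<tau> \<in> ?T. \<tau> x \<noteq> x} * B"
      using T(1) by (simp add: sum_distrib_right[symmetric] sum_of_bool_eq Int_def)
    also have "\<dots> / ?N \<le> (real n - 1) * B / ?N"
      using card_moving_transpositions[OF less.prems(3)] n B0 
      by (intro divide_right_mono mult_right_mono) (auto simp: of_nat_diff[symmetric] simp del: of_nat_diff)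
    also have "\<dots> = 2 / real n * B"
    proof -
      have "?N = real n * (real n - 1) / 2" using card_transpositions[of n] by simp
      moreover have "real n - 1 \<noteq> 0" using n by simp
      ultimately show ?thesis using n N by (simp add: divide_simps mult.commute)
    qed
    finally show ?thesis unfolding J_def .
  qed
  have "avg ?T I (\<lambda>s. card (component I s x)) \<le>
      avg ?T I (\<lambda>s. 1 + (\<Sum>t\<in>I. of_bool (s t x \<noteq> x) * real (card (component (I - {t}) s (s t x)))))"
    by (rule avg_mono[OF pt])
  also have "\<dots> = 1 + (\<Sum>t\<in>I. avg ?T I (\<lambda>s. of_bool (s t x \<noteq> x) * real (card (component (I - {t}) s (s t x)))))"
    by (simp only: avg_add avg_sum avg_const[OF T less.prems(1)])
  also have "\<dots> \<le> 1 + (\<Sum>t\<in>I. 2 / real n * B)" by (intro add_left_mono sum_mono branch)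
  also have "\<dots> = 1 + card I * (2 / real n * B)" by simp
  also have "\<dots> \<le> 1 + K * (2 / real n * B)"
    using less.prems B0 by (intro add_left_mono mult_right_mono) auto
  also have "\<dots> \<le> B" using B by (simp add: algebra_simps)
  finally show ?case .
qed

section \<open>Fragmentations and the first visit to a level\<close>

primrec chain :: "(nat \<Rightarrow> nat \<Rightarrow> nat) \<Rightarrow> nat \<Rightarrow> (nat \<Rightarrow> nat)" where
  "chain s 0 = id"
| "chain s (Suc k) = chain s k \<circ> s k"

lemma chain_cong: "(\<And>t. t < k \<Longrightarrow> s t = s' t) \<Longrightarrow> chain s k = chain s' k"
  by (induction k) auto

lemma chain_update: "k \<le> t \<Longrightarrow> chain (s(t := \<tau>)) k = chain s k"
  by (rule chain_cong) auto

lemma chain_permutes: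
  "(\<And>t. t < k \<Longrightarrow> s t \<in> transpositions n) \<Longrightarrow> chain s k permutes {1..n}"
proof (induction k)
  case 0
  show ?case unfolding chain.simps by (rule permutes_id)
next
  case (Suc k)
  have "chain s k permutes {1..n}" by (rule Suc.IH) (simp add: Suc.prems)
  then show ?case
    unfolding chain.simps by (intro permutes_compose transpositions_permutes[OF Suc.prems]) auto
qed

text \<open>A product of transpositions moves points only along the edges, so its cycles lie inside the
  components of the graph.\<close>

lemma orbit_chain_subset_component: "orbit (chain s k) x \<subseteq> component {..<k} s x"
proof -
  have closed: "chain s j y \<in> component {..<k} s x" if "j \<le> k" "y \<in> component {..<k} s x" for j y
    using that
  proof (induction j arbitrary: y)
    case (Suc j)
    then show ?case using component_step[of y "{..<k}" s x j] by auto
  qed simp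
  show ?thesis
  proof
    fix y assume "y \<in> orbit (chain s k) x"
    then show "y \<in> component {..<k} s x"
      by induction (auto intro: closed component_refl)
  qed
qed

text \<open>For a transposition: its two points lie on one cycle of \<open>p\<close>, which \<open>p \<circ> \<tau>\<close> splits.\<close>

definition fragments :: "(nat \<Rightarrow> nat) \<Rightarrow> (nat \<Rightarrow> nat) \<Rightarrow> bool" where
  "fragments \<tau> p \<longleftrightarrow> (\<exists>x. \<tau> x \<noteq> x \<and> \<tau> x \<in> orbit p x)"

definition num_fragmentations :: "(nat \<Rightarrow> nat \<Rightarrow> nat) \<Rightarrow> nat \<Rightarrow> real" where
  "num_fragmentations s K = (\<Sum>k<K. of_bool (fragments (s k) (chain s k)))"

lemma num_fragmentations_Suc:
  "num_fragmentations s (Suc k) =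
    num_fragmentations s k + of_bool (fragments (s k) (chain s k))"
  unfolding num_fragmentations_def by (rule sum.lessThan_Suc)

lemma fragments_transpose:
  assumes "permutation p" "fragments (Transposition.transpose x y) p"
  shows "y \<in> orbit p x"
proof -
  obtain z where z: "Transposition.transpose x y z \<noteq> z" "Transposition.transpose x y z \<in> orbit p z"
    using assms(2) by (auto simp: fragments_def)
  then consider "z = x" | "z = y" by (auto simp: Transposition.transpose_def split: if_splits)
  then show ?thesis
    using z orbit_swap[OF permutation_self_in_orbit[OF assms(1)]] by cases auto
qed

lemma cayley_dist_step:
  assumes "p permutes {1..n}" "\<tau> \<in> transpositions n"
  shows "real (cayley_dist n (p \<circ> \<tau>)) \<le> real (cayley_dist n p) + 1"
    and "real (cayley_dist n (p \<circ> \<tau>)) \<ge> real (cayley_dist n p) + 1 - 2 * of_bool (fragments \<tau> p)"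
proof -
  obtain x y where xy: "\<tau> = Transposition.transpose x y" "x \<in> {1..n}" "y \<in> {1..n}" "x \<noteq> y"
    using assms(2) by (rule in_transpositionsE)
  show "real (cayley_dist n (p \<circ> \<tau>)) \<le> real (cayley_dist n p) + 1"
    using cayley_dist_comp_transpose_le[OF assms(1) xy(2,3)] xy(1) by simp
  show "real (cayley_dist n (p \<circ> \<tau>)) \<ge> real (cayley_dist n p) + 1 - 2 * of_bool (fragments \<tau> p)"
  proof (cases "fragments \<tau> p")
    case True
    then show ?thesis using cayley_dist_comp_transpose_ge[OF assms(1) xy(2,3)] xy(1) by simp
  next
    case False
    then have "y \<notin> orbit p x"
      unfolding xy(1) fragments_def using xy(4) by (metis transpose_apply_first)
    then show ?thesis using cayley_dist_comp_transpose_merge[OF assms(1) xy(2,3)] xy(1) False by simp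
  qed
qed

lemma cayley_dist_chain_le:
  assumes "\<And>t. t < k \<Longrightarrow> s t \<in> transpositions n"
  shows "cayley_dist n (chain s k) \<le> k"
  using assms
proof (induction k)
  case 0
  then show ?case unfolding chain.simps cayley_dist_id by simp
next
  case (Suc k)
  have "real (cayley_dist n (chain s k \<circ> s k)) \<le> real (cayley_dist n (chain s k)) + 1"
    using Suc.prems by (intro cayley_dist_step chain_permutes) auto
  moreover have "cayley_dist n (chain s k) \<le> k" using Suc by simp
  ultimately show ?case unfolding chain.simps by linarith
qed

lemma cayley_dist_chain_ge:
  assumes "\<And>t. t < k \<Longrightarrow> s t \<in> transpositions n"
  shows "real k - 2 * num_fragmentations s k \<le> cayley_dist n (chain s k)"
  using assms
proof (induction k)
  case (Suc k)
  have "real (cayley_dist n (chain s k \<circ> s k)) \<ge>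
      real (cayley_dist n (chain s k)) + 1 - 2 * of_bool (fragments (s k) (chain s k))"
    using Suc.prems by (intro cayley_dist_step chain_permutes) auto
  moreover have "real k - 2 * num_fragmentations s k \<le> cayley_dist n (chain s k)"
    using Suc by simp
  ultimately show ?case unfolding chain.simps num_fragmentations_Suc of_nat_Suc distrib_left by linarith
qed (simp add: num_fragmentations_def)

text \<open>If at most \<open>l\<close> of the first \<open>m + 2 l\<close> steps split a cycle, then the level at that time is at least
  \<open>m\<close>. It rises by at most one per step, so \<open>m\<close> itself has been visited, and not before time \<open>m\<close>.\<close>

lemma level_hit:
  assumes s: "\<And>t. t < m + 2 * l \<Longrightarrow> s t \<in> transpositions n"
    and frag: "num_fragmentations s (m + 2 * l) \<le> real l"
  obtains k where "m \<le> k" "k \<le> m + 2 * l" "cayley_dist n (chain s k) = m"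
    "\<And>j. j < k \<Longrightarrow> cayley_dist n (chain s j) \<noteq> m"
proof -
  let ?d = "\<lambda>k. cayley_dist n (chain s k)" and ?K = "m + 2 * l"
  have "real m \<le> ?d ?K" using cayley_dist_chain_ge[OF s] frag by fastforce
  then have K: "m \<le> ?d ?K" by simp
  define k where "k = (LEAST k. m \<le> ?d k)"
  have k: "m \<le> ?d k" unfolding k_def using K by (rule LeastI)
  have kK: "k \<le> ?K" unfolding k_def using K by (rule Least_le)
  have less: "?d j < m" if "j < k" for j
    using not_less_Least[of j "\<lambda>k. m \<le> ?d k"] that unfolding k_def by simp
  have "?d k \<le> m"
  proof (cases k)
    case 0
    then show ?thesis using cayley_dist_id[of n] by simp
  next
    case (Suc j)
    have "real (cayley_dist n (chain s j \<circ> s j)) \<le> real (cayley_dist n (chain s j)) + 1"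
      using s Suc kK by (intro cayley_dist_step chain_permutes) auto
    then show ?thesis using less[of j] Suc by simp
  qed
  then have "?d k = m" using k by simp
  moreover from this have "m \<le> k" using cayley_dist_chain_le[of k s n] s kK by fastforce
  ultimately show thesis using that[of k] kK less by fastforce
qed

text \<open>Step \<open>k\<close> splits a cycle only if it joins two points of one component of the graph formed by the
  previous edges. Its endpoints are uniform, so the probability is at most the mean component size
  divided by \<open>n - 1\<close>. Hence the expected number of such steps stays bounded as \<open>n\<close> grows.\<close>

lemma avg_num_fragmentations:
  fixes B :: real
  assumes n: "n \<ge> 2" and B: "1 + 2 * real K / real n * B \<le> B" and B0: "0 \<le> B"
  shows "avg (transpositions n) {..<K} (\<lambda>s. num_fragmentations s K) \<le> real K * (B / (real n - 1))"
proof -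
  let ?T = "transpositions n"
  note T = finite_transpositions[of n] transpositions_nonempty[OF n]
  let ?N = "real (card ?T)"
  have one: "avg ?T {..<K} (\<lambda>s. of_bool (fragments (s k) (chain s k))) \<le> B / (real n - 1)"
    if k: "k < K" for k
  proof -
    have pt: "(\<Sum>\<tau>\<in>?T. of_bool (fragments \<tau> (chain s k))) / ?N \<le>
        (\<Sum>x\<in>{1..n}. real (card (component {..<k} s x))) / (real n * (real n - 1))"
      if s: "s \<in> {..<k} \<rightarrow>\<^sub>E ?T" for s
    proof -
      have st: "s t \<in> ?T" if "t < k" for t using s that by auto
      have perm: "permutation (chain s k)"
        unfolding permutation_permutes using chain_permutes[OF st]
        by (intro exI[of _ "{1..n}"] conjI) simp_all
      have "(\<Sum>y\<in>{1..n} - {x}. of_bool (fragments (Transposition.transpose x y) (chain s k))) \<le>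
          real (card (component {..<k} s x))" if x: "x \<in> {1..n}" for x
      proof -
        have "(\<Sum>y\<in>{1..n} - {x}. of_bool (fragments (Transposition.transpose x y) (chain s k))) =
            real (card (({1..n} - {x}) \<inter> {y. fragments (Transposition.transpose x y) (chain s k)}))"
          by (rule sum_of_bool_eq) auto
        also have "\<dots> \<le> card (component {..<k} s x)"
          using fragments_transpose[OF perm] orbit_chain_subset_component[of s k x]
            finite_subset[OF component_subset[of "{..<k}" s n x]] st x
          by (intro of_nat_mono card_mono) auto
        finally show ?thesis .
      qed
      then show ?thesis
        unfolding avg_transposition using n by (intro divide_right_mono sum_mono) auto
    qed
    have "avg ?T {..<K} (\<lambda>s. of_bool (fragments (s k) (chain s k))) =
        avg ?T (insert k {..<k}) (\<lambda>s. of_bool (fragments (s k) (chain s k)))"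
      unfolding lessThan_Suc[symmetric] using k
      by (intro avg_lessThan_mono[OF T]) (auto simp: chain_update)
    also have "\<dots> = avg ?T {..<k} (\<lambda>s. (\<Sum>\<tau>\<in>?T. of_bool (fragments \<tau> (chain s k))) / ?N)"
      by (subst avg_insert) (auto simp: chain_update)
    also have "\<dots> \<le> avg ?T {..<k} (\<lambda>s. 1 / (real n * (real n - 1)) *
        (\<Sum>x\<in>{1..n}. real (card (component {..<k} s x))))"
      by (intro avg_mono) (use pt in simp)
    also have "\<dots> = 1 / (real n * (real n - 1)) *
        (\<Sum>x\<in>{1..n}. avg ?T {..<k} (\<lambda>s. real (card (component {..<k} s x))))"
      by (simp only: avg_cmult avg_sum)
    also have "\<dots> \<le> 1 / (real n * (real n - 1)) * (\<Sum>x\<in>{1..n}. B)"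
      using n k by (intro mult_left_mono sum_mono avg_component[OF n B B0]) auto
    also have "\<dots> = B / (real n - 1)" using n by simp
    finally show ?thesis .
  qed
  have "avg ?T {..<K} (\<lambda>s. num_fragmentations s K) =
      (\<Sum>k<K. avg ?T {..<K} (\<lambda>s. of_bool (fragments (s k) (chain s k))))"
    unfolding num_fragmentations_def by (rule avg_sum)
  also have "\<dots> \<le> (\<Sum>k<K. B / (real n - 1))" by (intro sum_mono one) auto
  finally show ?thesis by simp
qed

definition first_hit_in :: "nat \<Rightarrow> nat \<Rightarrow> nat \<Rightarrow> (nat \<Rightarrow> nat) set \<Rightarrow> (nat \<Rightarrow> nat \<Rightarrow> nat) \<Rightarrow> bool" where
  "first_hit_in n m K A s \<longleftrightarrow> (\<exists>k\<le>K. cayley_dist n (chain s k) = m \<and>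
     (\<forall>j<k. cayley_dist n (chain s j) \<noteq> m) \<and> chain s k \<in> A)"

section \<open>Drift of the two counts in one step\<close>

abbreviation step_mean :: "nat \<Rightarrow> ((nat \<Rightarrow> nat) \<Rightarrow> real) \<Rightarrow> real" where
  "step_mean n h \<equiv> (\<Sum>\<tau>\<in>transpositions n. h \<tau>) / real (card (transpositions n))"

text \<open>A uniform transposition is the transposition of a uniform ordered pair of distinct points. Sums over
  such pairs factorise.\<close>

definition pair_sum :: "nat \<Rightarrow> (nat \<Rightarrow> nat \<Rightarrow> real) \<Rightarrow> real" where
  "pair_sum n g = (\<Sum>x\<in>{1..n}. \<Sum>y\<in>{1..n} - {x}. g x y)"

lemma pair_sum_mono:
  "(\<And>x y. x \<in> {1..n} \<Longrightarrow> y \<in> {1..n} \<Longrightarrow> x \<noteq> y \<Longrightarrow> g x y \<le> h x y) \<Longrightarrow> pair_sum n g \<le> pair_sum n h"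
  unfolding pair_sum_def by (intro sum_mono) auto

lemma pair_sum_cong:
  "(\<And>x y. x \<in> {1..n} \<Longrightarrow> y \<in> {1..n} \<Longrightarrow> x \<noteq> y \<Longrightarrow> g x y = h x y) \<Longrightarrow> pair_sum n g = pair_sum n h"
  unfolding pair_sum_def by (intro sum.cong) auto

lemma pair_sum_add: "pair_sum n (\<lambda>x y. g x y + h x y) = pair_sum n g + pair_sum n h"
  by (simp add: pair_sum_def sum.distrib)

lemma pair_sum_diff: "pair_sum n (\<lambda>x y. g x y - h x y) = pair_sum n g - pair_sum n h"
  by (simp add: pair_sum_def sum_subtractf)

lemma pair_sum_cmult: "pair_sum n (\<lambda>x y. c * g x y) = c * pair_sum n g"
  by (simp add: pair_sum_def sum_distrib_left)

lemma pair_sum_const: "pair_sum n (\<lambda>x y. c) = real n * (real n - 1) * c"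
proof -
  have "pair_sum n (\<lambda>x y. c) = (\<Sum>x\<in>{1..n}. (real n - 1) * c)"
    unfolding pair_sum_def by (intro sum.cong) (auto simp: of_nat_diff)
  then show ?thesis by simp
qed

lemma pair_sum_abs: "\<bar>pair_sum n g\<bar> \<le> pair_sum n (\<lambda>x y. \<bar>g x y\<bar>)"
  unfolding pair_sum_def by (intro order_trans[OF sum_abs] sum_mono sum_abs)

lemma pair_sum_fst: "pair_sum n (\<lambda>x y. g x) = (real n - 1) * (\<Sum>x\<in>{1..n}. g x)"
proof -
  have "pair_sum n (\<lambda>x y. g x) = (\<Sum>x\<in>{1..n}. (real n - 1) * g x)"
    unfolding pair_sum_def by (intro sum.cong) (auto simp: of_nat_diff)
  then show ?thesis by (simp add: sum_distrib_left)
qed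

lemma pair_sum_mult:
  "pair_sum n (\<lambda>x y. g x * h y) =
    (\<Sum>x\<in>{1..n}. g x) * (\<Sum>y\<in>{1..n}. h y) - (\<Sum>x\<in>{1..n}. g x * h x)"
proof -
  have "pair_sum n (\<lambda>x y. g x * h y) = (\<Sum>x\<in>{1..n}. g x * (\<Sum>y\<in>{1..n}. h y) - g x * h x)"
    unfolding pair_sum_def sum_distrib_left by (intro sum.cong refl) (simp add: sum_diff1)
  then show ?thesis by (simp add: sum_subtractf sum_distrib_right)
qed

lemma pair_sum_snd: "pair_sum n (\<lambda>x y. g y) = (real n - 1) * (\<Sum>x\<in>{1..n}. g x)"
  using pair_sum_mult[of n "\<lambda>_. 1" g] by (simp add: algebra_simps)

lemma pair_sum_graph:
  "0 \<le> pair_sum n (\<lambda>x y. of_bool (r x = y))" "pair_sum n (\<lambda>x y. of_bool (r x = y)) \<le> real n"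
  "0 \<le> pair_sum n (\<lambda>x y. of_bool (r y = x))" "pair_sum n (\<lambda>x y. of_bool (r y = x)) \<le> real n"
proof -
  have one: "(\<Sum>y\<in>A. of_bool (z = y)) \<le> (1::real)" if "finite A" for z :: nat and A
    using that by (simp add: of_bool_def sum.delta')
  have "pair_sum n (\<lambda>x y. of_bool (r x = y)) \<le> (\<Sum>x\<in>{1..n}. 1)"
    unfolding pair_sum_def by (intro sum_mono one) auto
  then show "pair_sum n (\<lambda>x y. of_bool (r x = y)) \<le> real n" by simp
  have "pair_sum n (\<lambda>x y. of_bool (r y = x)) \<le> (\<Sum>x\<in>{1..n}. \<Sum>y\<in>{1..n}. of_bool (r y = x))"
    unfolding pair_sum_def by (intro sum_mono sum_mono2) auto
  also have "\<dots> = (\<Sum>y\<in>{1..n}. \<Sum>x\<in>{1..n}. of_bool (r y = x))" by (rule sum.swap)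
  also have "\<dots> \<le> (\<Sum>y\<in>{1..n}. 1)" by (intro sum_mono one) auto
  finally show "pair_sum n (\<lambda>x y. of_bool (r y = x)) \<le> real n" by simp
qed (auto simp: pair_sum_def intro!: sum_nonneg)

lemma step_mean_pair_sum:
  "step_mean n h = pair_sum n (\<lambda>x y. h (Transposition.transpose x y)) / (real n * (real n - 1))"
  unfolding pair_sum_def by (rule avg_transposition)

text \<open>The recursion for a second moment: if the increment is bounded by \<open>M\<close>, only its mean, the drift,
  multiplies the current deviation.\<close>

lemma step_mean_square:
  assumes n: "n \<ge> 2" and Y: "\<And>\<tau>. \<tau> \<in> transpositions n \<Longrightarrow> \<bar>Y \<tau>\<bar> \<le> M"
  shows "step_mean n (\<lambda>\<tau>. (D + Y \<tau>)\<^sup>2) \<le> D\<^sup>2 + 2 * D * step_mean n Y + M\<^sup>2"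
proof -
  let ?T = "transpositions n" let ?N = "real (card ?T)"
  have N: "?N > 0" using finite_transpositions[of n] transpositions_nonempty[OF n] by (simp add: card_gt_0_iff)
  have "(\<Sum>\<tau>\<in>?T. (D + Y \<tau>)\<^sup>2) \<le> (\<Sum>\<tau>\<in>?T. D\<^sup>2 + 2 * D * Y \<tau> + M\<^sup>2)"
  proof (rule sum_mono)
    fix \<tau> assume "\<tau> \<in> ?T"
    then have "(Y \<tau>)\<^sup>2 \<le> M\<^sup>2" using Y[of \<tau>] by (intro abs_le_square_iff[THEN iffD1]) auto
    then show "(D + Y \<tau>)\<^sup>2 \<le> D\<^sup>2 + 2 * D * Y \<tau> + M\<^sup>2" by (simp add: power2_sum)
  qed
  also have "\<dots> = ?N * D\<^sup>2 + 2 * D * (\<Sum>\<tau>\<in>?T. Y \<tau>) + ?N * M\<^sup>2"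
    by (simp add: sum.distrib sum_distrib_left)
  finally have "step_mean n (\<lambda>\<tau>. (D + Y \<tau>)\<^sup>2) \<le> (?N * D\<^sup>2 + 2 * D * (\<Sum>\<tau>\<in>?T. Y \<tau>) + ?N * M\<^sup>2) / ?N"
    by (rule divide_right_mono) simp
  also have "\<dots> = D\<^sup>2 + 2 * D * step_mean n Y + M\<^sup>2" using N by (simp add: add_divide_distrib)
  finally show ?thesis .
qed

lemma cancel_pairs:
  assumes "n \<ge> 2"
  shows "k * (real n - 1) * a / (real n * (real n - 1)) = k * a / real n"
proof -
  have "real n - 1 \<noteq> 0" using assms by simp
  then have "((real n - 1) * (k * a)) / ((real n - 1) * real n) = k * a / real n"
    by (rule mult_divide_mult_cancel_left)
  then show ?thesis by (simp only: ac_simps)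
qed

text \<open>Each endpoint of the transposition destroys a fixed point with probability \<open>F / n\<close>. The error \<open>e\<close>
  comes from the pairs that are adjacent on a cycle, whose split creates fixed points.\<close>

lemma step_mean_num_fixed:
  assumes n: "n \<ge> 2"
  obtains e where "step_mean n (\<lambda>\<tau>. num_fixed n (p \<circ> \<tau>) - num_fixed n p - c) =
      - 2 * num_fixed n p / n + e - c" "0 \<le> e" "e \<le> 2 / (real n - 1)"
proof -
  let ?f = "\<lambda>x. of_bool (p x = x) :: real" and ?F = "num_fixed n p"
  let ?S = "pair_sum n (\<lambda>x y. of_bool (p x = y)) + pair_sum n (\<lambda>x y. of_bool (p y = x))"
  define e where "e = ?S / (real n * (real n - 1))"
  have n1: "real n * (real n - 1) > 0" using n by simp
  have "pair_sum n (\<lambda>x y. num_fixed n (p \<circ> Transposition.transpose x y) - ?F - c) =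
     pair_sum n (\<lambda>x y. of_bool (p x = y) + of_bool (p y = x) - ?f x - ?f y - c)"
    by (intro pair_sum_cong) (simp add: num_fixed_comp_transpose)
  also have "\<dots> = ?S - (real n - 1) * ?F - (real n - 1) * ?F - real n * (real n - 1) * c"
    unfolding pair_sum_diff pair_sum_add pair_sum_const
      pair_sum_fst[of n ?f] pair_sum_snd[of n ?f] num_fixed_sum ..
  finally have *: "pair_sum n (\<lambda>x y. num_fixed n (p \<circ> Transposition.transpose x y) - ?F - c) =
      ?S - 2 * (real n - 1) * ?F - real n * (real n - 1) * c" by simp
  have 1: "step_mean n (\<lambda>\<tau>. num_fixed n (p \<circ> \<tau>) - ?F - c) = - 2 * ?F / n + e - c"
    unfolding step_mean_pair_sum * e_def diff_divide_distrib cancel_pairs[OF n] using n by simp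
  have S: "0 \<le> ?S" "?S \<le> 2 * real n" using pair_sum_graph[of n p] by simp_all
  have "e \<le> 2 * real n / (real n * (real n - 1))"
    unfolding e_def using S n1 by (intro divide_right_mono) auto
  also have "\<dots> = 2 / (real n - 1)" using n by simp
  finally have 2: "e \<le> 2 / (real n - 1)" .
  have 3: "0 \<le> e" unfolding e_def using S n1 by (intro divide_nonneg_pos) auto
  show thesis by (rule that[OF 1 3 2])
qed

text \<open>The drift of \<open>F\<close> pulls the deviation from the solution of the recursion \<open>f \<mapsto> (1 - 2 / n) f\<close> towards zero, so the
  second moment of the deviation grows only by a constant per step: at most 16 from the squared
  increment and at most 8 from the error in the drift.\<close>

lemma step_num_fixed:
  assumes n: "n \<ge> 2" and f: "0 \<le> f" "f \<le> real n"
  shows "step_mean n (\<lambda>\<tau>. (num_fixed n (p \<circ> \<tau>) - (1 - 2 / n) * f)\<^sup>2) \<le> (num_fixed n p - f)\<^sup>2 + 24"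
proof -
  let ?F = "num_fixed n p"
  let ?D = "?F - f" and ?Y = "\<lambda>\<tau>. num_fixed n (p \<circ> \<tau>) - ?F - (- 2 * f / n)"
  have fn: "0 \<le> 2 * f / n" "2 * f / n \<le> 2" using f n by (auto simp: field_simps)
  have "\<bar>?Y \<tau>\<bar> \<le> 4" if \<tau>: "\<tau> \<in> transpositions n" for \<tau>
  proof -
    obtain x y where xy: "\<tau> = Transposition.transpose x y" "x \<in> {1..n}" "y \<in> {1..n}" "x \<noteq> y"
      using \<tau> by (rule in_transpositionsE)
    show ?thesis using num_fixed_comp_transpose_diff[OF xy(2-4), of p] fn unfolding xy(1) by linarith
  qed
  then have "step_mean n (\<lambda>\<tau>. (?D + ?Y \<tau>)\<^sup>2) \<le> ?D\<^sup>2 + 2 * ?D * step_mean n ?Y + 4\<^sup>2"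
    by (rule step_mean_square[OF n])
  moreover have "2 * ?D * step_mean n ?Y \<le> 8"
  proof -
    obtain e where e: "step_mean n ?Y = - 2 * ?F / n + e - (- 2 * f / n)" "0 \<le> e" "e \<le> 2 / (real n - 1)"
      by (rule step_mean_num_fixed[OF n])
    have *: "step_mean n ?Y = - 2 / n * ?D + e"
      unfolding e(1) using n by (simp add: field_simps)
    have "2 * ?D * step_mean n ?Y = - (4 / n * ?D\<^sup>2) + 2 * (?D * e)"
      unfolding * by (simp add: algebra_simps power2_eq_square diff_divide_distrib add_divide_distrib)
    also have "\<dots> \<le> 2 * (?D * e)" by simp
    also have "?D * e \<le> real n * (2 / (real n - 1))"
    proof -
      have "?D \<le> real n" using num_fixed_bounds[of n p] f by linarith
      then have "?D * e \<le> real n * e" using e(2) by (rule mult_right_mono)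
      also have "\<dots> \<le> real n * (2 / (real n - 1))" using e(3) by (rule mult_left_mono) simp
      finally show ?thesis .
    qed
    also have "real n * (2 / (real n - 1)) \<le> 4" using n by (simp add: field_simps)
    finally show ?thesis by simp
  qed
  ultimately have "step_mean n (\<lambda>\<tau>. (?D + ?Y \<tau>)\<^sup>2) \<le> ?D\<^sup>2 + 24" by simp
  moreover have "(\<lambda>\<tau>. (?D + ?Y \<tau>)\<^sup>2) = (\<lambda>\<tau>. (num_fixed n (p \<circ> \<tau>) - (1 - 2 / n) * f)\<^sup>2)"
    by (simp add: algebra_simps)
  ultimately show ?thesis by (simp only:)
qed

text \<open>Unless one endpoint is reached from the other in one or two steps of \<open>p\<close>, no 2-cycle can be
  split off. Then 2-cycles arise only by joining two fixed points, and a 2-cycle disappears exactly when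
  it contains an endpoint.\<close>

lemma two_cycle_points_comp_transpose:
  assumes p: "p permutes {1..n}" and xy: "x \<in> {1..n}" "y \<in> {1..n}" "x \<noteq> y"
    and far: "p x \<noteq> y" "p y \<noteq> x" "p (p x) \<noteq> y" "p (p y) \<noteq> x"
  shows "two_cycle_points n (p \<circ> Transposition.transpose x y) =
    (two_cycle_points n p - {x, p x, y, p y}) \<union> (if p x = x \<and> p y = y then {x, y} else {})"
    (is "two_cycle_points n ?q = ?R")
proof -
  have inj: "p u = p v \<longleftrightarrow> u = v" for u v using permutes_inj[OF p] by (auto dest: injD)
  have qx: "?q x = p y" and qy: "?q y = p x" and qz: "\<And>z. z \<noteq> x \<Longrightarrow> z \<noteq> y \<Longrightarrow> ?q z = p z"
    by simp_all
  note q_simp = qx qy qz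
  have "z \<in> two_cycle_points n ?q \<longleftrightarrow> z \<in> ?R" for z
  proof -
    consider "z = x" | "z = y" | "z \<noteq> x" "z \<noteq> y" "p z = x" | "z \<noteq> x" "z \<noteq> y" "p z = y"
      | "z \<noteq> x" "z \<noteq> y" "p z \<noteq> x" "p z \<noteq> y" by blast
    then show ?thesis
    proof cases
      case 1
      have "?q (?q x) = x \<longleftrightarrow> p x = x \<and> p y = y"
        unfolding qx using far xy qy qz[of "p y"] by (cases "p y = y") auto
      then show ?thesis using 1 xy far by (auto simp: two_cycle_points_def simp del: comp_apply simp: qx)
    next
      case 2
      have "?q (?q y) = y \<longleftrightarrow> p x = x \<and> p y = y"
        unfolding qy using far xy qx qz[of "p x"] by (cases "p x = x") auto
      then show ?thesis using 2 xy far by (auto simp: two_cycle_points_def simp del: comp_apply simp: qy)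
    next
      case 3
      then have "?q (?q z) \<noteq> z" using far by (simp add: inj) metis
      moreover have "p (p z) \<noteq> z \<or> z = p x" using 3 by auto
      ultimately show ?thesis using 3 by (auto simp: two_cycle_points_def)
    next
      case 4
      then have "?q (?q z) \<noteq> z" using far by (simp add: inj) metis
      moreover have "p (p z) \<noteq> z \<or> z = p y" using 4 by auto
      ultimately show ?thesis using 4 by (auto simp: two_cycle_points_def)
    next
      case 5
      then have "?q z = p z" "?q (?q z) = p (p z)" by simp_all
      moreover have "p (p z) = z \<Longrightarrow> z \<noteq> p x \<and> z \<noteq> p y" using 5 by (auto simp: inj)
      ultimately show ?thesis using 5 by (auto simp: two_cycle_points_def)
    qed
  qed
  then show ?thesis by blast
qed

lemma num_two_comp_transpose:
  fixes p :: "nat \<Rightarrow> nat" and n x y :: nat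
  defines "fx \<equiv> \<lambda>z. of_bool (p z = z) :: real"
    and "tw \<equiv> \<lambda>z. of_bool (z \<in> two_cycle_points n p) :: real"
  assumes p: "p permutes {1..n}" and xy: "x \<in> {1..n}" "y \<in> {1..n}" "x \<noteq> y"
    and far: "p x \<noteq> y" "p y \<noteq> x" "p (p x) \<noteq> y" "p (p y) \<noteq> x"
  shows "num_two n (p \<circ> Transposition.transpose x y) =
    num_two n p + 2 * (fx x * fx y) - 2 * tw x - 2 * tw y"
proof -
  let ?A = "two_cycle_points n p" and ?E = "{x, p x, y, p y}"
  have A: "p z \<in> ?A \<longleftrightarrow> z \<in> ?A" if "z \<in> {1..n}" for z
    using that permutes_in_image[OF p] injD[OF permutes_inj[OF p]] unfolding two_cycle_points_def by auto
  have ne: "z \<in> ?A \<Longrightarrow> p z \<noteq> z" for z by (auto simp: two_cycle_points_def)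
  have inj: "p u = p v \<longleftrightarrow> u = v" for u v using permutes_inj[OF p] by (auto dest: injD)
  let ?X = "\<lambda>z. if z \<in> ?A then {z, p z} else {}"
  have X: "card (?X z) = (if z \<in> ?A then 2 else 0)" for z using ne[of z] by auto
  have "?A \<inter> ?E = ?X x \<union> ?X y"
    using A[OF xy(1)] A[OF xy(2)] by auto
  moreover have "{x, p x} \<inter> {y, p y} = {}" using xy far by (auto simp: inj)
  then have "?X x \<inter> ?X y = {}" by auto
  ultimately have "card (?A \<inter> ?E) = (if x \<in> ?A then 2 else 0) + (if y \<in> ?A then 2 else 0)"
    using card_Un_disjoint[of "?X x" "?X y"] unfolding X by simp
  then have 1: "real (card (?A \<inter> ?E)) = 2 * tw x + 2 * tw y" by (simp add: tw_def)
  have 2: "real (card (?A - ?E)) = num_two n p - real (card (?A \<inter> ?E))"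
    unfolding num_two_def using card_Diff_subset_Int[of ?A ?E] card_mono[of ?A "?A \<inter> ?E"]
    by (simp add: of_nat_diff)
  have "real (card ((?A - ?E) \<union> (if p x = x \<and> p y = y then {x, y} else {}))) =
      real (card (?A - ?E)) + 2 * (fx x * fx y)"
    using xy by (subst card_Un_disjoint) (auto simp: fx_def)
  then show ?thesis
    unfolding num_two_def two_cycle_points_comp_transpose[OF p xy far]
    using 1 2 unfolding num_two_def by linarith
qed

text \<open>The exceptional pairs are at distance one or two on a cycle; there are at most \<open>4 n\<close> of them among
  the \<open>n (n - 1)\<close> pairs, and for each the expression is wrong by at most 8.\<close>

lemma step_mean_num_two:
  assumes n: "n \<ge> 2" and p: "p permutes {1..n}"
  obtains e where "step_mean n (\<lambda>\<tau>. num_two n (p \<circ> \<tau>) - num_two n p - c) =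
      2 * num_fixed n p * (num_fixed n p - 1) / (n * (real n - 1)) - 4 * num_two n p / n + e - c"
    "\<bar>e\<bar> \<le> 32 / (real n - 1)"
proof -
  let ?f = "\<lambda>x. of_bool (p x = x) :: real" and ?F = "num_fixed n p" and ?Q = "num_two n p"
  let ?t = "\<lambda>x. of_bool (x \<in> two_cycle_points n p) :: real"
  let ?Q' = "\<lambda>x y. num_two n (p \<circ> Transposition.transpose x y)"
  define err where "err x y = ?Q' x y - (?Q + 2 * (?f x * ?f y) - 2 * ?t x - 2 * ?t y)" for x y
  define e where "e = pair_sum n err / (real n * (real n - 1))"
  have n1: "real n * (real n - 1) > 0" using n by simp
  have t: "(\<Sum>x\<in>{1..n}. ?t x) = ?Q"
  proof -
    have "(\<Sum>x\<in>{1..n}. ?t x) = real (card ({1..n} \<inter> {x. x \<in> two_cycle_points n p}))"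
      by (rule sum_of_bool_eq) auto
    also have "{1..n} \<inter> {x. x \<in> two_cycle_points n p} = two_cycle_points n p"
      by (auto simp: two_cycle_points_def)
    finally show ?thesis by (simp add: num_two_def)
  qed
  have ff: "(\<Sum>x\<in>{1..n}. ?f x * ?f x) = ?F"
    unfolding num_fixed_sum by (intro sum.cong) auto
  have "pair_sum n (\<lambda>x y. ?Q' x y - ?Q - c) =
     pair_sum n (\<lambda>x y. err x y + 2 * (?f x * ?f y) - 2 * ?t x - 2 * ?t y - c)"
    by (intro pair_sum_cong) (simp add: err_def)
  also have "\<dots> = pair_sum n err + 2 * (?F * ?F - ?F) - 2 * ((real n - 1) * ?Q)
      - 2 * ((real n - 1) * ?Q) - real n * (real n - 1) * c"
    unfolding pair_sum_diff pair_sum_add pair_sum_const pair_sum_cmult pair_sum_mult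
      pair_sum_fst[of n ?t] pair_sum_snd[of n ?t] t ff unfolding num_fixed_sum ..
  finally have *: "pair_sum n (\<lambda>x y. ?Q' x y - ?Q - c) =
      pair_sum n err + 2 * ?F * (?F - 1) - 4 * (real n - 1) * ?Q - real n * (real n - 1) * c"
    by (simp add: algebra_simps)
  have 1: "step_mean n (\<lambda>\<tau>. num_two n (p \<circ> \<tau>) - ?Q - c) =
      2 * ?F * (?F - 1) / (n * (real n - 1)) - 4 * ?Q / n + e - c"
  proof -
    have "real n * (real n - 1) * c / (real n * (real n - 1)) = c" using n by simp
    then show ?thesis
      unfolding step_mean_pair_sum * e_def diff_divide_distrib add_divide_distrib cancel_pairs[OF n] by simp
  qed
  let ?b = "\<lambda>x y. of_bool (p x = y) + of_bool (p y = x) + of_bool ((p \<circ> p) x = y) + of_bool ((p \<circ> p) y = x) :: real"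
  have err: "\<bar>err x y\<bar> \<le> 8 * ?b x y" if xy: "x \<in> {1..n}" "y \<in> {1..n}" "x \<noteq> y" for x y
  proof (cases "p x \<noteq> y \<and> p y \<noteq> x \<and> p (p x) \<noteq> y \<and> p (p y) \<noteq> x")
    case True
    then have "err x y = 0"
      unfolding err_def using num_two_comp_transpose[OF p xy] by simp
    then show ?thesis by simp
  next
    case False
    then have "1 \<le> ?b x y" by auto
    moreover have "0 \<le> ?f x * ?f y" "?f x * ?f y \<le> 1" "0 \<le> ?t x" "?t x \<le> 1" "0 \<le> ?t y" "?t y \<le> 1"
      by auto
    moreover have "\<bar>q' - (q + 2 * f - 2 * t - 2 * t')\<bar> \<le> 8 * b"
      if "1 \<le> b" "0 \<le> f" "f \<le> 1" "0 \<le> t" "t \<le> 1" "0 \<le> t'" "t' \<le> 1" "\<bar>q' - q\<bar> \<le> 4"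
      for q q' f t t' b :: real using that by linarith
    ultimately show ?thesis
      unfolding err_def using num_two_comp_transpose_diff[OF p xy(1,2)] by blast
  qed
  have "\<bar>pair_sum n err\<bar> \<le> pair_sum n (\<lambda>x y. 8 * ?b x y)"
    by (rule order_trans[OF pair_sum_abs pair_sum_mono[OF err]])
  also have "\<dots> \<le> 32 * real n"
  proof -
    have aux: "8 * (b1 + b2 + b3 + b4) \<le> 32 * z" if "b1 \<le> z" "b2 \<le> z" "b3 \<le> z" "b4 \<le> z"
      for b1 b2 b3 b4 z :: real using that by simp
    show ?thesis unfolding pair_sum_cmult pair_sum_add by (rule aux; rule pair_sum_graph)
  qed
  finally have "\<bar>pair_sum n err\<bar> \<le> 32 * real n" .
  then have "\<bar>e\<bar> \<le> 32 * real n / (real n * (real n - 1))"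
    unfolding e_def abs_divide abs_of_pos[OF n1] using n1 by (intro divide_right_mono) auto
  also have "\<dots> = 32 / (real n - 1)" using n by simp
  finally have 2: "\<bar>e\<bar> \<le> 32 / (real n - 1)" .
  show thesis by (rule that[OF 1 2])
qed

text \<open>In the drift of \<open>Q\<close> the deviation \<open>D\<close> of the fixed points appears through \<open>(F / n)\<^sup>2\<close>. Its product
  with the deviation \<open>G\<close> of \<open>Q\<close> is absorbed by the contracting term \<open>- 8 G\<^sup>2 / n\<close>, which leaves
  \<open>2 D\<^sup>2 / n\<close>. The coefficient of \<open>G\<^sup>2\<close> stays 1, so the second moment grows linearly in time.\<close>

lemma step_num_two:
  fixes n :: nat and f q :: real
  defines "u \<equiv> 1 - 2 / real n"
  assumes n: "n \<ge> 2" and p: "p permutes {1..n}"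
    and f: "0 \<le> f" "f \<le> n" and q: "0 \<le> q" "q \<le> 2 * real n"
  shows "step_mean n (\<lambda>\<tau>. (num_two n (p \<circ> \<tau>) - (u\<^sup>2 * q + 2 * (f / n)\<^sup>2))\<^sup>2) \<le>
    (num_two n p - q)\<^sup>2 + 2 * (num_fixed n p - f)\<^sup>2 / n + 500"
proof -
  let ?F = "num_fixed n p" and ?Q = "num_two n p" and ?N = "real n"
  define D G where "D = ?F - f" and "G = ?Q - q"
  define c where "c = (u\<^sup>2 - 1) * q + 2 * (f / n)\<^sup>2"
  let ?Y = "\<lambda>\<tau>. num_two n (p \<circ> \<tau>) - ?Q - c"
  have N: "?N \<ge> 2" using n by simp
  have u1: "u\<^sup>2 - 1 = - 4 / n + 4 / n\<^sup>2" using n by (simp add: u_def power2_eq_square field_simps)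
  have c: "\<bar>c\<bar> \<le> 10"
  proof -
    have "0 \<le> (2 / ?N) * (2 - 2 / ?N)" "(2 / ?N) * (2 - 2 / ?N) \<le> (2 / ?N) * 2" using N 
      by (auto intro!: mult_nonneg_nonneg mult_left_mono simp: field_simps)
    moreover have "1 - u\<^sup>2 = (2 / ?N) * (2 - 2 / ?N)" unfolding u_def by (simp add: power2_eq_square algebra_simps)
    ultimately have "0 \<le> 1 - u\<^sup>2" "1 - u\<^sup>2 \<le> 4 / ?N" by simp_all
    then have "(1 - u\<^sup>2) * q \<le> (4 / ?N) * (2 * n)" "0 \<le> (1 - u\<^sup>2) * q"
      using q N by (intro mult_mono, simp_all)
    then have "(1 - u\<^sup>2) * q \<le> 8" "0 \<le> (1 - u\<^sup>2) * q" using N by simp_all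
    moreover have "0 \<le> f / n" "f / n \<le> 1" using f N by simp_all
    then have "0 \<le> (f / n)\<^sup>2" "(f / n)\<^sup>2 \<le> 1" by (simp_all add: power_le_one)
    moreover have "c = 2 * (f / n)\<^sup>2 - (1 - u\<^sup>2) * q" unfolding c_def by (simp add: algebra_simps)
    ultimately show ?thesis by linarith
  qed
  have Y: "\<bar>?Y \<tau>\<bar> \<le> 14" if \<tau>: "\<tau> \<in> transpositions n" for \<tau>
  proof -
    obtain x y where xy: "\<tau> = Transposition.transpose x y" "x \<in> {1..n}" "y \<in> {1..n}" "x \<noteq> y"
      using \<tau> by (rule in_transpositionsE)
    show ?thesis using num_two_comp_transpose_diff[OF p xy(2,3)] c unfolding xy(1) by linarith
  qed
  obtain e where e: "step_mean n ?Y =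
      2 * ?F * (?F - 1) / (n * (?N - 1)) - 4 * ?Q / n + e - c" "\<bar>e\<bar> \<le> 32 / (?N - 1)"
    by (rule step_mean_num_two[OF n p])
  define w i where "w = step_mean n ?Y + 4 * G / n" and "i = 1 / ?N"
  have frac: "k / ?N = k * i" for k by (simp add: i_def)
  have i0: "0 \<le> i" by (simp add: i_def)
  have w: "\<bar>w\<bar> \<le> 4 * (\<bar>D\<bar> * i) + 76 * i"
  proof -
    define A1 A2 A3 where "A1 = 4 * q / ?N\<^sup>2" and "A2 = 2 * (?F * (?N - ?F) / (?N\<^sup>2 * (?N - 1)))"
      and "A3 = 2 * (D * (?F + f) / ?N\<^sup>2)"
    have half: "1 / (?N - 1) \<le> 2 * i" using N by (simp add: i_def field_simps)
    have "w = e - A1 - A2 + A3"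
    proof -
      have "2 * ?F * (?F - 1) / (n * (?N - 1)) - 2 * (?F / n)\<^sup>2 = - A2"
        unfolding A2_def using N by (simp add: field_simps power2_eq_square)
      moreover have "2 * (?F / n)\<^sup>2 - 2 * (f / n)\<^sup>2 = A3"
        unfolding A3_def D_def by (simp add: power2_eq_square algebra_simps diff_divide_distrib)
      moreover have "- 4 * ?Q / n - (u\<^sup>2 - 1) * q + 4 * G / n = - A1"
        unfolding A1_def u1 G_def by (simp add: power2_eq_square algebra_simps diff_divide_distrib)
      ultimately show ?thesis using c_def unfolding w_def e(1) by linarith
    qed
    moreover have "0 \<le> A1" "A1 \<le> 8 * i"
    proof -
      show "0 \<le> A1" using q unfolding A1_def by simp
      have "A1 \<le> 4 * (2 * ?N) / ?N\<^sup>2" unfolding A1_def using q by (intro divide_right_mono) auto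
      then show "A1 \<le> 8 * i" using N by (simp add: power2_eq_square i_def)
    qed
    moreover have "0 \<le> A2" "A2 \<le> 4 * i"
    proof -
      have b: "0 \<le> ?F * (?N - ?F)" "?F * (?N - ?F) \<le> ?N * ?N"
        using num_fixed_bounds[of n p] by (auto intro!: mult_mono mult_nonneg_nonneg)
      have d: "0 \<le> ?N\<^sup>2 * (?N - 1)" using N by (intro mult_nonneg_nonneg) auto
      show "0 \<le> A2" unfolding A2_def using divide_nonneg_nonneg[OF b(1) d] by simp
      have "?F * (?N - ?F) / (?N\<^sup>2 * (?N - 1)) \<le> ?N * ?N / (?N\<^sup>2 * (?N - 1))"
        by (intro divide_right_mono b d)
      also have "\<dots> = 1 / (?N - 1)" using N by (simp add: power2_eq_square)
      finally show "A2 \<le> 4 * i" unfolding A2_def using half by linarith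
    qed
    moreover have "\<bar>A3\<bar> \<le> 4 * (\<bar>D\<bar> * i)"
    proof -
      have "\<bar>D * (?F + f)\<bar> \<le> \<bar>D\<bar> * (2 * ?N)"
        unfolding abs_mult using num_fixed_bounds[of n p] f by (intro mult_left_mono) auto
      then have "\<bar>D * (?F + f)\<bar> / ?N\<^sup>2 \<le> \<bar>D\<bar> * (2 * ?N) / ?N\<^sup>2" by (intro divide_right_mono) auto
      moreover have "\<bar>D\<bar> * (2 * ?N) / ?N\<^sup>2 = 2 * (\<bar>D\<bar> * i)" using N by (simp add: power2_eq_square i_def)
      moreover have "\<bar>A3\<bar> = 2 * (\<bar>D * (?F + f)\<bar> / ?N\<^sup>2)" unfolding A3_def by (simp add: abs_mult)
      ultimately show ?thesis by linarith
    qed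
    moreover have "\<bar>e\<bar> \<le> 64 * i"
    proof -
      have "32 / (?N - 1) = 32 * (1 / (?N - 1))" by simp
      then show ?thesis using e(2) half by linarith
    qed
    ultimately show ?thesis by linarith
  qed
  have G: "\<bar>G\<bar> \<le> 2 * ?N" using num_two_bounds[of n p] q unfolding G_def by linarith
  have "2 * G * step_mean n ?Y \<le> 2 * (D\<^sup>2 * i) + 304"
  proof -
    have "G * w \<le> \<bar>G\<bar> * \<bar>w\<bar>" using abs_ge_self[of "G * w"] by (simp only: abs_mult)
    also have "\<dots> \<le> \<bar>G\<bar> * (4 * (\<bar>D\<bar> * i) + 76 * i)" by (intro mult_left_mono w) simp
    also have "\<dots> = 4 * (\<bar>G\<bar> * \<bar>D\<bar> * i) + 76 * (\<bar>G\<bar> * i)" by (simp add: algebra_simps)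
    finally have 1: "G * w \<le> 4 * (\<bar>G\<bar> * \<bar>D\<bar> * i) + 76 * (\<bar>G\<bar> * i)" .
    have 2: "\<bar>G\<bar> * i \<le> 2" using G N by (simp add: i_def field_simps)
    have "0 \<le> 2 * (2 * \<bar>G\<bar> - \<bar>D\<bar>)\<^sup>2" by simp
    then have "8 * \<bar>G\<bar> * \<bar>D\<bar> - 8 * G\<^sup>2 \<le> 2 * D\<^sup>2" by (simp add: power2_diff power_mult_distrib)
    then have "(8 * \<bar>G\<bar> * \<bar>D\<bar> - 8 * G\<^sup>2) * i \<le> 2 * D\<^sup>2 * i" by (rule mult_right_mono[OF _ i0])
    then have 3: "8 * (\<bar>G\<bar> * \<bar>D\<bar> * i) - 8 * (G\<^sup>2 * i) \<le> 2 * (D\<^sup>2 * i)" by (simp add: algebra_simps)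
    have "step_mean n ?Y = w - 4 * (G * i)" by (simp add: w_def frac)
    then have "2 * G * step_mean n ?Y = 2 * G * (w - 4 * (G * i))" by (simp only:)
    also have "\<dots> = 2 * (G * w) - 8 * (G\<^sup>2 * i)" by (simp add: algebra_simps power2_eq_square)
    finally show ?thesis using 1 2 3 by linarith
  qed
  moreover have "step_mean n (\<lambda>\<tau>. (G + ?Y \<tau>)\<^sup>2) \<le> G\<^sup>2 + 2 * G * step_mean n ?Y + 14\<^sup>2"
    by (rule step_mean_square[OF n Y])
  moreover have "(\<lambda>\<tau>. (G + ?Y \<tau>)\<^sup>2) = (\<lambda>\<tau>. (num_two n (p \<circ> \<tau>) - (u\<^sup>2 * q + 2 * (f / n)\<^sup>2))\<^sup>2)"
    by (simp add: G_def c_def algebra_simps)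
  ultimately have "step_mean n (\<lambda>\<tau>. (num_two n (p \<circ> \<tau>) - (u\<^sup>2 * q + 2 * (f / n)\<^sup>2))\<^sup>2) \<le>
      G\<^sup>2 + (2 * (D\<^sup>2 * i) + 304) + 14\<^sup>2"
    by (simp only:)
  then show ?thesis by (simp add: G_def D_def frac)
qed

section \<open>Concentration of the two counts\<close>

text \<open>The solutions of the drift equations of the two counts, started with \<open>n\<close> fixed points and no
  2-cycle.\<close>

definition fixed_mean :: "nat \<Rightarrow> nat \<Rightarrow> real" where
  "fixed_mean n k = real n * (1 - 2 / real n) ^ k"

definition two_mean :: "nat \<Rightarrow> nat \<Rightarrow> real" where
  "two_mean n k = 2 * real k * ((1 - 2 / real n)\<^sup>2) ^ (k - 1)"

lemma avg_lessThan_Suc: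
  "avg T {..<Suc k} h = avg T {..<k} (\<lambda>s. (\<Sum>\<tau>\<in>T. h (s(k := \<tau>))) / real (card T))"
  unfolding lessThan_Suc by (rule avg_insert) auto

lemma fixed_mean_bounds:
  assumes "n \<ge> 2"
  shows "0 \<le> fixed_mean n k" "fixed_mean n k \<le> real n"
proof -
  have u: "0 \<le> 1 - 2 / real n" "1 - 2 / real n \<le> 1" using assms by (auto simp: field_simps)
  have "(1 - 2 / real n) ^ k \<le> 1" using u by (rule power_le_one)
  then have "real n * (1 - 2 / real n) ^ k \<le> real n * 1" by (intro mult_left_mono) auto
  then show "fixed_mean n k \<le> real n" by (simp add: fixed_mean_def)
  show "0 \<le> fixed_mean n k" unfolding fixed_mean_def using u by simp
qed

lemma two_mean_bounds:
  assumes "n \<ge> 2"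
  shows "0 \<le> two_mean n k" "two_mean n k \<le> 2 * real k"
proof -
  have u: "0 \<le> 1 - 2 / real n" "1 - 2 / real n \<le> 1" using assms by (auto simp: field_simps)
  then have u2: "0 \<le> (1 - 2 / real n)\<^sup>2" "(1 - 2 / real n)\<^sup>2 \<le> 1" by (auto intro: power_le_one)
  have "((1 - 2 / real n)\<^sup>2) ^ (k - 1) \<le> 1" using u2 by (rule power_le_one)
  then have "2 * real k * ((1 - 2 / real n)\<^sup>2) ^ (k - 1) \<le> 2 * real k * 1" by (intro mult_left_mono) auto
  then show "two_mean n k \<le> 2 * real k" by (simp add: two_mean_def)
  show "0 \<le> two_mean n k" unfolding two_mean_def using u2 by simp
qed

lemma fixed_mean_Suc: "fixed_mean n (Suc k) = (1 - 2 / real n) * fixed_mean n k"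
  by (simp add: fixed_mean_def)

lemma two_mean_Suc:
  assumes "n \<ge> 1"
  shows "two_mean n (Suc k) = (1 - 2 / real n)\<^sup>2 * two_mean n k + 2 * (fixed_mean n k / real n)\<^sup>2"
proof -
  define v where "v = (1 - 2 / real n)\<^sup>2"
  have "fixed_mean n k / real n = (1 - 2 / real n) ^ k" using assms by (simp add: fixed_mean_def)
  then have "(fixed_mean n k / real n)\<^sup>2 = v ^ k"
    unfolding v_def by (simp flip: power_mult add: mult.commute)
  moreover have "two_mean n (Suc k) = v * two_mean n k + 2 * v ^ k"
    by (cases k) (auto simp: two_mean_def v_def[symmetric] algebra_simps)
  ultimately show ?thesis by (simp add: v_def)
qed

lemma avg_fixed_deviation:
  assumes n: "n \<ge> 2"
  shows "avg (transpositions n) {..<k} (\<lambda>s. (num_fixed n (chain s k) - fixed_mean n k)\<^sup>2) \<le> 24 * real k"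
proof (induction k)
  case 0
  have "num_fixed n (\<lambda>a. a) = real n" unfolding num_fixed_sum by simp
  then show ?case by (simp add: avg_def fixed_mean_def)
next
  case (Suc k)
  let ?T = "transpositions n"
  note T = finite_transpositions[of n] transpositions_nonempty[OF n]
  have "avg ?T {..<Suc k} (\<lambda>s. (num_fixed n (chain s (Suc k)) - fixed_mean n (Suc k))\<^sup>2) =
      avg ?T {..<k} (\<lambda>s. step_mean n (\<lambda>\<tau>. (num_fixed n (chain s k \<circ> \<tau>) - (1 - 2 / n) * fixed_mean n k)\<^sup>2))"
    unfolding avg_lessThan_Suc fixed_mean_Suc by (simp add: chain_update)
  also have "\<dots> \<le> avg ?T {..<k} (\<lambda>s. (num_fixed n (chain s k) - fixed_mean n k)\<^sup>2 + 24)"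
    by (intro avg_mono step_num_fixed n fixed_mean_bounds)
  also have "\<dots> = avg ?T {..<k} (\<lambda>s. (num_fixed n (chain s k) - fixed_mean n k)\<^sup>2) + 24"
    by (simp only: avg_add avg_const[OF T finite_lessThan])
  also have "\<dots> \<le> 24 * real (Suc k)" using Suc by simp
  finally show ?case .
qed

lemma avg_two_deviation:
  assumes n: "n \<ge> 2" and k: "k \<le> n"
  shows "avg (transpositions n) {..<k} (\<lambda>s. (num_two n (chain s k) - two_mean n k)\<^sup>2) \<le> 548 * real k"
  using k
proof (induction k)
  case 0
  have "two_cycle_points n (\<lambda>a. a) = {}" by (auto simp: two_cycle_points_def)
  then have "num_two n (\<lambda>a. a) = 0" unfolding num_two_def by simp
  then show ?case by (simp add: avg_def two_mean_def)
next
  case (Suc k)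
  let ?T = "transpositions n"
  note T = finite_transpositions[of n] transpositions_nonempty[OF n]
  have q: "two_mean n k \<le> 2 * real n" using two_mean_bounds(2)[OF n, of k] Suc.prems by simp
  have perm: "chain s k permutes {1..n}" if "s \<in> {..<k} \<rightarrow>\<^sub>E ?T" for s
    by (rule chain_permutes) (use that in auto)
  have "two_mean n (Suc k) = (1 - 2 / real n)\<^sup>2 * two_mean n k + 2 * (fixed_mean n k / real n)\<^sup>2"
    using n by (intro two_mean_Suc) simp
  then have "avg ?T {..<Suc k} (\<lambda>s. (num_two n (chain s (Suc k)) - two_mean n (Suc k))\<^sup>2) =
      avg ?T {..<k} (\<lambda>s. step_mean n (\<lambda>\<tau>. (num_two n (chain s k \<circ> \<tau>) -
        ((1 - 2 / real n)\<^sup>2 * two_mean n k + 2 * (fixed_mean n k / real n)\<^sup>2))\<^sup>2))"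
    unfolding avg_lessThan_Suc by (simp add: chain_update)
  also have "\<dots> \<le> avg ?T {..<k} (\<lambda>s. (num_two n (chain s k) - two_mean n k)\<^sup>2 +
      2 * (num_fixed n (chain s k) - fixed_mean n k)\<^sup>2 / n + 500)"
    by (intro avg_mono step_num_two n fixed_mean_bounds two_mean_bounds q perm)
  also have "\<dots> = avg ?T {..<k} (\<lambda>s. (num_two n (chain s k) - two_mean n k)\<^sup>2 +
      2 / n * (num_fixed n (chain s k) - fixed_mean n k)\<^sup>2 + 500)" by simp
  also have "\<dots> = avg ?T {..<k} (\<lambda>s. (num_two n (chain s k) - two_mean n k)\<^sup>2) +
      2 / n * avg ?T {..<k} (\<lambda>s. (num_fixed n (chain s k) - fixed_mean n k)\<^sup>2) + 500"
    by (simp only: avg_add avg_cmult avg_const[OF T finite_lessThan])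
  also have "\<dots> \<le> 548 * real k + 2 / n * (24 * real k) + 500"
    using Suc by (intro add_mono mult_left_mono avg_fixed_deviation n) auto
  finally have *: "avg ?T {..<Suc k} (\<lambda>s. (num_two n (chain s (Suc k)) - two_mean n (Suc k))\<^sup>2) \<le>
      548 * real k + 2 / n * (24 * real k) + 500" .
  have "2 / n * (24 * real k) \<le> 48" using Suc.prems n by (simp add: field_simps)
  then have "548 * real k + 2 / n * (24 * real k) + 500 \<le> 548 * real (Suc k)" by simp
  with * show ?case by (rule order_trans)
qed

lemma avg_markov:
  assumes "0 < c" "\<And>s. 0 \<le> h s"
  shows "avg T I (\<lambda>s. of_bool (c \<le> h s)) \<le> avg T I h / c"
proof -
  have "avg T I (\<lambda>s. of_bool (c \<le> h s)) \<le> avg T I (\<lambda>s. 1 / c * h s)"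
    using assms by (intro avg_mono) (auto simp: of_bool_def field_simps)
  also have "\<dots> = avg T I h / c" unfolding avg_cmult by simp
  finally show ?thesis .
qed

lemma chain_lipschitz:
  assumes "\<And>t. t < k \<Longrightarrow> s t \<in> transpositions n" "m \<le> k"
  shows "\<bar>num_fixed n (chain s k) - num_fixed n (chain s m)\<bar> \<le> 2 * (real k - real m)"
    and "\<bar>num_two n (chain s k) - num_two n (chain s m)\<bar> \<le> 4 * (real k - real m)"
proof -
  have "\<bar>num_fixed n (chain s k) - num_fixed n (chain s m)\<bar> \<le> 2 * (real k - real m) \<and>
    \<bar>num_two n (chain s k) - num_two n (chain s m)\<bar> \<le> 4 * (real k - real m)"
    using assms(2,1)
  proof (induction k rule: dec_induct)
    case (step k)
    obtain x y where xy: "s k = Transposition.transpose x y" "x \<in> {1..n}" "y \<in> {1..n}" "x \<noteq> y"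
      using step.prems[of k] by (auto elim: in_transpositionsE)
    have p: "chain s k permutes {1..n}" by (rule chain_permutes) (use step.prems in auto)
    have IH: "\<bar>num_fixed n (chain s k) - num_fixed n (chain s m)\<bar> \<le> 2 * (real k - real m) \<and>
      \<bar>num_two n (chain s k) - num_two n (chain s m)\<bar> \<le> 4 * (real k - real m)"
      by (rule step.IH) (use step.prems in auto)
    have "\<bar>num_fixed n (chain s (Suc k)) - num_fixed n (chain s k)\<bar> \<le> 2"
      unfolding chain.simps xy(1) by (rule num_fixed_comp_transpose_diff[OF xy(2-4)])
    moreover have "\<bar>num_two n (chain s (Suc k)) - num_two n (chain s k)\<bar> \<le> 4"
      unfolding chain.simps xy(1) by (rule num_two_comp_transpose_diff[OF p xy(2,3)])
    ultimately show ?case using IH unfolding of_nat_Suc right_diff_distrib distrib_left by linarith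
  qed simp
  then show "\<bar>num_fixed n (chain s k) - num_fixed n (chain s m)\<bar> \<le> 2 * (real k - real m)"
    "\<bar>num_two n (chain s k) - num_two n (chain s m)\<bar> \<le> 4 * (real k - real m)" by auto
qed

definition typical_set :: "nat \<Rightarrow> nat \<Rightarrow> real \<Rightarrow> (nat \<Rightarrow> nat) set" where
  "typical_set n m r = {p. p permutes {1..n} \<and> cayley_dist n p = m \<and>
     \<bar>num_fixed n p - fixed_mean n m\<bar> \<le> r \<and> num_two n p \<le> two_mean n m + r}"

text \<open>Chebyshev's inequality controls both counts at the fixed time \<open>m\<close>, and Markov's inequality controls
  the number of splits. The first visit to the level happens at most \<open>2 l\<close> steps after time \<open>m\<close>, and
  the counts change by at most 2 and 4 per step, so they are still near their means then.\<close>

lemma typical_hit: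
  fixes B \<epsilon> :: real
  assumes n: "n \<ge> 2" and l: "l \<ge> 1" and m: "m \<le> n" and \<epsilon>: "0 < \<epsilon>"
    and B: "1 + 2 * real (m + 2 * l) / real n * B \<le> B" and B0: "0 \<le> B"
  shows "1 - (real (m + 2 * l) * (B / (real n - 1)) / real l + 572 * real m / (\<epsilon> * n)\<^sup>2) \<le>
    avg (transpositions n) {..<m + 2 * l}
      (\<lambda>s. of_bool (first_hit_in n m (m + 2 * l) (typical_set n m (\<epsilon> * n + 8 * real l)) s))"
proof -
  let ?T = "transpositions n" and ?K = "m + 2 * l"
  let ?fr = "\<lambda>s. num_fragmentations s ?K"
  let ?D = "\<lambda>s. (num_fixed n (chain s m) - fixed_mean n m)\<^sup>2"
  let ?G = "\<lambda>s. (num_two n (chain s m) - two_mean n m)\<^sup>2"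
  let ?good = "\<lambda>s. of_bool (first_hit_in n m ?K (typical_set n m (\<epsilon> * n + 8 * real l)) s) :: real"
  let ?e = "\<epsilon> * real n"
  note T = finite_transpositions[of n] transpositions_nonempty[OF n]
  have e: "0 < ?e" using \<epsilon> n by simp
  \<comment> \<open>one of the three bad events occurs unless the hit is typical\<close>
  have pt: "1 \<le> ?good s + of_bool (real l \<le> ?fr s) + of_bool (?e\<^sup>2 \<le> ?D s) + of_bool (?e\<^sup>2 \<le> ?G s)"
    if s: "s \<in> {..<?K} \<rightarrow>\<^sub>E ?T" for s
  proof (cases "real l \<le> ?fr s \<or> ?e\<^sup>2 \<le> ?D s \<or> ?e\<^sup>2 \<le> ?G s")
    case True
    then show ?thesis by auto
  next
    case False
    have st: "s t \<in> ?T" if "t < ?K" for t using s that by auto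
    have frag: "?fr s \<le> real l" using False by simp
    have DG: "\<bar>num_fixed n (chain s m) - fixed_mean n m\<bar> \<le> ?e" "\<bar>num_two n (chain s m) - two_mean n m\<bar> \<le> ?e"
    proof -
      have "\<bar>x\<bar> \<le> ?e" if "\<not> ?e\<^sup>2 \<le> x\<^sup>2" for x :: real
        using abs_le_square_iff[of x ?e] e that by auto
      then show "\<bar>num_fixed n (chain s m) - fixed_mean n m\<bar> \<le> ?e"
        "\<bar>num_two n (chain s m) - two_mean n m\<bar> \<le> ?e" using False by blast+
    qed
    obtain k where k: "m \<le> k" "k \<le> ?K" "cayley_dist n (chain s k) = m"
        "\<And>j. j < k \<Longrightarrow> cayley_dist n (chain s j) \<noteq> m"
      using level_hit[OF st frag] by blast
    have st': "s t \<in> ?T" if "t < k" for t using st that k(2) by simp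
    have perm: "chain s k permutes {1..n}" by (rule chain_permutes) (rule st')
    have kl: "real k - real m \<le> 2 * real l" using k(2) by linarith
    have lip: "\<bar>num_fixed n (chain s k) - num_fixed n (chain s m)\<bar> \<le> 2 * (real k - real m)"
      "\<bar>num_two n (chain s k) - num_two n (chain s m)\<bar> \<le> 4 * (real k - real m)"
      by (rule chain_lipschitz[OF _ k(1)]; erule st')+
    have "\<bar>num_fixed n (chain s k) - fixed_mean n m\<bar> \<le> ?e + 8 * real l"
      "num_two n (chain s k) \<le> two_mean n m + (?e + 8 * real l)"
      using lip DG kl unfolding right_diff_distrib by linarith+
    then have "chain s k \<in> typical_set n m (?e + 8 * real l)"
      unfolding typical_set_def using perm k(3) by simp
    then have "first_hit_in n m ?K (typical_set n m (?e + 8 * real l)) s"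
      unfolding first_hit_in_def using k by blast
    then show ?thesis by simp
  qed
  \<comment> \<open>the state at time \<open>m\<close> does not depend on the later steps\<close>
  have mK: "avg ?T {..<?K} (\<lambda>s. h (chain s m)) = avg ?T {..<m} (\<lambda>s. h (chain s m))" for h
    by (rule avg_lessThan_mono[OF T]) (auto simp: chain_update)
  have e2: "0 < ?e\<^sup>2" by (rule zero_less_power[OF e])
  have "1 = avg ?T {..<?K} (\<lambda>s. 1)" by (simp add: avg_const[OF T])
  also have "\<dots> \<le> avg ?T {..<?K} (\<lambda>s. ?good s + of_bool (real l \<le> ?fr s) + of_bool (?e\<^sup>2 \<le> ?D s) + of_bool (?e\<^sup>2 \<le> ?G s))"
    by (rule avg_mono[OF pt])
  also have "\<dots> = avg ?T {..<?K} ?good + avg ?T {..<?K} (\<lambda>s. of_bool (real l \<le> ?fr s))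
     + avg ?T {..<?K} (\<lambda>s. of_bool (?e\<^sup>2 \<le> ?D s)) + avg ?T {..<?K} (\<lambda>s. of_bool (?e\<^sup>2 \<le> ?G s))"
    by (simp only: avg_add)
  finally have main: "1 \<le> avg ?T {..<?K} ?good + avg ?T {..<?K} (\<lambda>s. of_bool (real l \<le> ?fr s))
     + avg ?T {..<?K} (\<lambda>s. of_bool (?e\<^sup>2 \<le> ?D s)) + avg ?T {..<?K} (\<lambda>s. of_bool (?e\<^sup>2 \<le> ?G s))" .
  have 1: "avg ?T {..<?K} (\<lambda>s. of_bool (real l \<le> ?fr s)) \<le> real ?K * (B / (real n - 1)) / real l"
  proof -
    have "avg ?T {..<?K} (\<lambda>s. of_bool (real l \<le> ?fr s)) \<le> avg ?T {..<?K} ?fr / real l"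
      using l by (intro avg_markov) (auto simp: num_fragmentations_def intro: sum_nonneg)
    also have "\<dots> \<le> real ?K * (B / (real n - 1)) / real l"
      by (intro divide_right_mono avg_num_fragmentations n B B0) auto
    finally show ?thesis .
  qed
  have 2: "avg ?T {..<?K} (\<lambda>s. of_bool (?e\<^sup>2 \<le> ?D s)) \<le> 24 * real m / ?e\<^sup>2"
  proof -
    have "avg ?T {..<?K} (\<lambda>s. of_bool (?e\<^sup>2 \<le> ?D s)) \<le> avg ?T {..<?K} ?D / ?e\<^sup>2"
      by (rule avg_markov[OF e2]) simp
    also have "avg ?T {..<?K} ?D = avg ?T {..<m} ?D" by (rule mK)
    also have "\<dots> / ?e\<^sup>2 \<le> 24 * real m / ?e\<^sup>2" by (intro divide_right_mono avg_fixed_deviation n) simp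
    finally show ?thesis .
  qed
  have 3: "avg ?T {..<?K} (\<lambda>s. of_bool (?e\<^sup>2 \<le> ?G s)) \<le> 548 * real m / ?e\<^sup>2"
  proof -
    have "avg ?T {..<?K} (\<lambda>s. of_bool (?e\<^sup>2 \<le> ?G s)) \<le> avg ?T {..<?K} ?G / ?e\<^sup>2"
      by (rule avg_markov[OF e2]) simp
    also have "avg ?T {..<?K} ?G = avg ?T {..<m} ?G" by (rule mK)
    also have "\<dots> / ?e\<^sup>2 \<le> 548 * real m / ?e\<^sup>2" by (intro divide_right_mono avg_two_deviation n m) simp
    finally show ?thesis .
  qed
  have "572 * real m / ?e\<^sup>2 = 24 * real m / ?e\<^sup>2 + 548 * real m / ?e\<^sup>2" by (simp flip: add_divide_distrib)
  then show ?thesis using main 1 2 3 by linarith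
qed

section \<open>The hitting distribution\<close>

lemma jump_chain_eq_chain: "jump_chain \<omega> k = chain (\<lambda>i. snd (\<omega> i)) k"
  by (induction k) auto

lemma jump_time_strict_mono:
  assumes "\<And>i. 0 < fst (\<omega> i)"
  shows "strict_mono (jump_time \<omega>)"
  by (rule strict_mono_Suc_iff[THEN iffD2]) (simp add: jump_time_def assms)

lemma walk_at_jump_time:
  assumes pos: "\<And>i. 0 < fst (\<omega> i)"
  shows "walk (jump_time \<omega> k) \<omega> = jump_chain \<omega> k"
proof -
  have "{j. 1 \<le> j \<and> jump_time \<omega> j \<le> jump_time \<omega> k} = {1..k}"
    using strict_mono_less_eq[OF jump_time_strict_mono[OF pos]] by auto
  then show ?thesis by (simp add: walk_def num_jumps_def)
qed

lemma num_jumps_less: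
  assumes pos: "\<And>i. 0 < fst (\<omega> i)" and t: "t < jump_time \<omega> k" and k: "1 \<le> k"
  shows "num_jumps \<omega> t < k"
proof -
  have "{j. 1 \<le> j \<and> jump_time \<omega> j \<le> t} \<subseteq> {1..<k}"
  proof clarify
    fix j assume j: "1 \<le> j" "jump_time \<omega> j \<le> t"
    then have "jump_time \<omega> j < jump_time \<omega> k" using t by linarith
    then have "j < k" using strict_mono_less[OF jump_time_strict_mono[OF pos]] by simp
    then show "j \<in> {1..<k}" using j by simp
  qed
  then have "num_jumps \<omega> t \<le> card {1..<k}" unfolding num_jumps_def by (intro card_mono) auto
  then show ?thesis using k by simp
qed

text \<open>Before the \<open>k\<close>-th jump time fewer than \<open>k\<close> jumps have occurred, so the walk is then at an earlier
  state of the chain and off the level. The identity has level 0 and \<open>m \<ge> 1\<close>, so the first visit takes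
  place at a positive time.\<close>

lemma hitting_time_eq:
  assumes pos: "\<And>i. 0 < fst (\<omega> i)" and m: "\<lfloor>a * real n\<rfloor> = int m" "1 \<le> m"
    and k: "cayley_dist n (jump_chain \<omega> k) = m" "\<And>j. j < k \<Longrightarrow> cayley_dist n (jump_chain \<omega> j) \<noteq> m"
  shows "hitting_time a n \<omega> = jump_time \<omega> k"
proof -
  have k1: "1 \<le> k" using k(1) m(2) cayley_dist_id[of n] by (cases k) auto
  have "jump_time \<omega> 0 < jump_time \<omega> k"
    using strict_monoD[OF jump_time_strict_mono[OF pos], of 0 k] k1 by simp
  then have T: "0 < jump_time \<omega> k" by (simp add: jump_time_def)
  show ?thesis
    unfolding hitting_time_def m(1) of_nat_eq_iff
  proof (rule cInf_eq_minimum)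
    show "jump_time \<omega> k \<in> {t. 0 < t \<and> cayley_dist n (walk t \<omega>) = m}"
      using T k(1) walk_at_jump_time[OF pos] by simp
    fix t assume t: "t \<in> {t. 0 < t \<and> cayley_dist n (walk t \<omega>) = m}"
    show "jump_time \<omega> k \<le> t"
    proof (rule ccontr)
      assume "\<not> jump_time \<omega> k \<le> t"
      then have "num_jumps \<omega> t < k" using k1 by (intro num_jumps_less[OF pos]) auto
      then show False using k(2) t unfolding walk_def by simp
    qed
  qed
qed

abbreviation jump_law :: "nat \<Rightarrow> (real \<times> (nat \<Rightarrow> nat)) measure" where
  "jump_law n \<equiv> density lborel (\<lambda>x. ennreal (exponential_density 1 x)) \<Otimes>\<^sub>M
     measure_pmf (pmf_of_set (transpositions n))"

lemma prob_space_exponential: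
  "prob_space (density lborel (\<lambda>x. ennreal (exponential_density 1 x)))"
  by (rule prob_space_exponential_density) simp

lemma pair_prob_space_jump_law:
  "pair_prob_space (density lborel (\<lambda>x. ennreal (exponential_density 1 x)))
     (measure_pmf (pmf_of_set (transpositions n)))"
  unfolding pair_prob_space_def pair_sigma_finite_def
  by (intro conjI prob_space_imp_sigma_finite prob_space_exponential prob_space_measure_pmf)

lemma prob_space_jump_law: "prob_space (jump_law n)"
  by (rule prob_space_pair[OF prob_space_exponential prob_space_measure_pmf])

lemma AE_jump_law:
  assumes n: "n \<ge> 2"
  shows "AE x in jump_law n. 0 < fst x \<and> snd x \<in> transpositions n"
proof -
  let ?E = "density lborel (\<lambda>x. ennreal (exponential_density 1 x))"
  let ?Q = "pmf_of_set (transpositions n)"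
  interpret pair_prob_space ?E "measure_pmf ?Q" by (rule pair_prob_space_jump_law)
  have [measurable]: "Measurable.pred (count_space UNIV) (\<lambda>s. s \<in> transpositions n)" by simp
  have "AE y in measure_pmf ?Q. y \<in> transpositions n"
    using finite_transpositions[of n] transpositions_nonempty[OF n] by (simp add: AE_measure_pmf_iff)
  moreover have "AE x in ?E. 0 < x"
  proof -
    have "AE x in lborel. x \<noteq> (0::real)" by (rule AE_lborel_singleton)
    then have "AE x in lborel. 0 < ennreal (exponential_density 1 x) \<longrightarrow> 0 < x"
      by eventually_elim (auto simp: exponential_density_def split: if_splits)
    then show ?thesis by (subst AE_density) auto
  qed
  ultimately have "AE x in ?E. AE y in measure_pmf ?Q. 0 < fst (x, y) \<and> snd (x, y) \<in> transpositions n"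
    by auto
  then show ?thesis by (intro AE_pair_measure) measurable
qed

definition jump_sequences :: "nat \<Rightarrow> (nat \<Rightarrow> real \<times> (nat \<Rightarrow> nat)) measure" where
  "jump_sequences n = (\<Pi>\<^sub>M i\<in>UNIV. jump_law n)"

lemma walk_space_eq: "walk_space n = completion (jump_sequences n)"
  by (simp add: walk_space_def jump_sequences_def)

lemma prob_space_jump_sequences: "prob_space (jump_sequences n)"
  unfolding jump_sequences_def by (rule prob_space_PiM) (rule prob_space_jump_law)

lemma AE_jump_sequences:
  assumes n: "n \<ge> 2"
  shows "AE \<omega> in jump_sequences n. \<forall>i. 0 < fst (\<omega> i) \<and> snd (\<omega> i) \<in> transpositions n"
proof (rule AE_all_countable[THEN iffD2], rule allI)
  fix i :: nat
  show "AE \<omega> in jump_sequences n. 0 < fst (\<omega> i) \<and> snd (\<omega> i) \<in> transpositions n"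
    unfolding jump_sequences_def
    by (rule AE_PiM_component[where P = "\<lambda>x. 0 < fst x \<and> snd x \<in> transpositions n"],
        rule prob_space_jump_law, rule UNIV_I, rule AE_jump_law[OF n])
qed

lemma measurable_coordinates:
  "(\<lambda>\<omega>. fst (\<omega> i)) \<in> borel_measurable (jump_sequences n)"
  "(\<lambda>\<omega>. snd (\<omega> i)) \<in> jump_sequences n \<rightarrow>\<^sub>M count_space UNIV"
proof -
  have i: "(\<lambda>\<omega>. \<omega> i) \<in> jump_sequences n \<rightarrow>\<^sub>M jump_law n"
    unfolding jump_sequences_def by (rule measurable_component_singleton) simp
  have "fst \<in> jump_law n \<rightarrow>\<^sub>M borel" "snd \<in> jump_law n \<rightarrow>\<^sub>M count_space UNIV"
    using measurable_fst[of "density lborel (\<lambda>x. ennreal (exponential_density 1 x))" "measure_pmf (pmf_of_set (transpositions n))"]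
      measurable_snd[of "density lborel (\<lambda>x. ennreal (exponential_density 1 x))" "measure_pmf (pmf_of_set (transpositions n))"]
    by (simp_all add: measurable_def)
  from this[THEN measurable_compose[OF i]]
  show "(\<lambda>\<omega>. fst (\<omega> i)) \<in> borel_measurable (jump_sequences n)"
    "(\<lambda>\<omega>. snd (\<omega> i)) \<in> jump_sequences n \<rightarrow>\<^sub>M count_space UNIV" by simp_all
qed

text \<open>Replacing the improper jumps, which form a null set, by the identity leaves finitely many
  possible steps, and composition with one of finitely many steps is measurable for the discrete
  sigma-algebra.\<close>

definition clean_jumps :: "nat \<Rightarrow> (nat \<Rightarrow> real \<times> (nat \<Rightarrow> nat)) \<Rightarrow> nat \<Rightarrow> nat \<Rightarrow> nat" where
  "clean_jumps n \<omega> i = (if snd (\<omega> i) \<in> transpositions n then snd (\<omega> i) else id)"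

lemma measurable_clean_chain:
  "(\<lambda>\<omega>. chain (clean_jumps n \<omega>) k) \<in> jump_sequences n \<rightarrow>\<^sub>M count_space UNIV"
proof (induction k)
  case (Suc k)
  let ?I = "insert id (transpositions n)"
  have g: "(\<lambda>\<omega>. clean_jumps n \<omega> k) \<in> jump_sequences n \<rightarrow>\<^sub>M count_space ?I"
    unfolding clean_jumps_def
    by (rule measurable_compose[OF measurable_coordinates(2)]) auto
  have f: "(\<lambda>\<omega>. chain (clean_jumps n \<omega>) k \<circ> s) \<in> jump_sequences n \<rightarrow>\<^sub>M count_space UNIV" for s
    by (rule measurable_compose[OF Suc]) simp
  show ?case
    unfolding chain.simps
    by (rule measurable_compose_countable'[OF f g]) (simp add: finite_transpositions countable_finite)
qed simp

lemma measurable_num_jumps: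
  "(\<lambda>\<omega>. num_jumps \<omega> t) \<in> jump_sequences n \<rightarrow>\<^sub>M count_space UNIV"
proof -
  note [measurable] = measurable_coordinates(1)
  have [measurable]: "(\<lambda>\<omega>. jump_time \<omega> k) \<in> borel_measurable (jump_sequences n)" for k
    unfolding jump_time_def by measurable
  show ?thesis unfolding num_jumps_def by measurable
qed

text \<open>Outside a null set the position at the hitting time agrees with a function that is measurable without
  completion: if the level is visited, the position at the first visit; otherwise the position of the walk
  at the fixed real number \<open>Inf {}\<close>.\<close>

lemma measurable_walk_at_hitting_time:
  assumes n: "n \<ge> 2" and m: "\<lfloor>a * real n\<rfloor> = int m" "1 \<le> m"
  shows "(\<lambda>\<omega>. walk (hitting_time a n \<omega>) \<omega>) \<in> walk_space n \<rightarrow>\<^sub>M count_space UNIV"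
proof -
  let ?P = "jump_sequences n"
  let ?c = "\<lambda>\<omega>. chain (clean_jumps n \<omega>)"
  let ?hit = "\<lambda>\<omega> k. cayley_dist n (?c \<omega> k) = m"
  define g where "g \<omega> = ?c \<omega> (if \<exists>k. ?hit \<omega> k then LEAST k. ?hit \<omega> k else num_jumps \<omega> (Inf {}))" for \<omega>
  note [measurable] = measurable_clean_chain measurable_num_jumps
  have [measurable]: "Measurable.pred ?P (\<lambda>\<omega>. ?hit \<omega> k)" for k
    by (rule measurable_compose[OF measurable_clean_chain]) simp
  have "(\<lambda>\<omega>. if \<exists>k. ?hit \<omega> k then LEAST k. ?hit \<omega> k else num_jumps \<omega> (Inf {})) \<in> ?P \<rightarrow>\<^sub>M count_space UNIV"
    by measurable
  then have g: "g \<in> ?P \<rightarrow>\<^sub>M count_space UNIV"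
    unfolding g_def by (rule measurable_compose_countable[OF measurable_clean_chain])
  have eq: "walk (hitting_time a n \<omega>) \<omega> = g \<omega>"
    if \<omega>: "\<forall>i. 0 < fst (\<omega> i) \<and> snd (\<omega> i) \<in> transpositions n" for \<omega>
  proof -
    have pos: "0 < fst (\<omega> i)" for i using \<omega> by blast
    have c: "?c \<omega> k = jump_chain \<omega> k" for k
      unfolding jump_chain_eq_chain by (rule chain_cong) (simp add: clean_jumps_def \<omega>)
    show ?thesis
    proof (cases "\<exists>k. ?hit \<omega> k")
      case True
      define k where "k = (LEAST k. ?hit \<omega> k)"
      have k: "?hit \<omega> k" unfolding k_def using True by (rule LeastI_ex)
      have less: "\<not> ?hit \<omega> j" if "j < k" for j using that not_less_Least unfolding k_def by blast
      have "hitting_time a n \<omega> = jump_time \<omega> k"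
        using k less unfolding c by (intro hitting_time_eq[OF pos m]) auto
      then show ?thesis unfolding g_def using True walk_at_jump_time[OF pos] c k_def by simp
    next
      case False
      then have "hitting_time a n \<omega> = Inf {}"
        unfolding hitting_time_def m(1) of_nat_eq_iff walk_def c by simp
      then show ?thesis unfolding g_def using False c by (simp add: walk_def)
    qed
  qed
  show ?thesis
  proof (rule measurableI)
    fix A :: "(nat \<Rightarrow> nat) set"
    let ?f = "\<lambda>\<omega>. walk (hitting_time a n \<omega>) \<omega>"
    have "AE \<omega> in walk_space n. \<omega> \<in> g -` A \<inter> space ?P \<longleftrightarrow> \<omega> \<in> ?f -` A \<inter> space (walk_space n)"
      unfolding walk_space_eq using AE_completion[OF AE_jump_sequences[OF n]]
      by eventually_elim (simp add: eq)
    moreover have "g -` A \<inter> space ?P \<in> sets (walk_space n)"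
      unfolding walk_space_eq using measurable_sets[OF g, of A] by simp
    ultimately show "?f -` A \<inter> space (walk_space n) \<in> sets (walk_space n)"
      unfolding walk_space_eq by (rule completion.in_sets_AE) simp
  qed simp
qed

lemma measure_first_jumps:
  assumes n: "n \<ge> 2" and s: "s \<in> {..<K} \<rightarrow>\<^sub>E transpositions n"
  shows "{\<omega> \<in> space (jump_sequences n). \<forall>i<K. snd (\<omega> i) = s i} \<in> sets (jump_sequences n)"
    and "measure (jump_sequences n) {\<omega> \<in> space (jump_sequences n). \<forall>i<K. snd (\<omega> i) = s i} =
      1 / real (card (transpositions n)) ^ K"
proof -
  let ?E = "density lborel (\<lambda>x. ennreal (exponential_density 1 x))"
  let ?Q = "measure_pmf (pmf_of_set (transpositions n))"
  let ?N = "real (card (transpositions n))"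
  interpret E: prob_space ?E by (rule prob_space_exponential)
  interpret J: product_prob_space "\<lambda>_::nat. jump_law n" UNIV
    by (intro product_prob_spaceI prob_space_jump_law)
  define X where "X i = space ?E \<times> {s i}" for i
  have X: "X i \<in> sets (jump_law n)" for i unfolding X_def by (intro pair_measureI) auto
  have sp: "space (jump_sequences n) = UNIV"
    by (simp add: jump_sequences_def space_PiM space_pair_measure)
  have set: "{\<omega> \<in> space (jump_sequences n). \<forall>i<K. snd (\<omega> i) = s i} =
      prod_emb UNIV (\<lambda>_. jump_law n) {..<K} (Pi\<^sub>E {..<K} X)"
  proof -
    have "\<omega> \<in> X i \<longleftrightarrow> snd \<omega> = s i" for i \<omega>
      unfolding X_def by (simp add: mem_Times_iff)
    moreover have "space (jump_law n) = UNIV" by (simp add: space_pair_measure)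
    ultimately have "\<omega> \<in> prod_emb UNIV (\<lambda>_. jump_law n) {..<K} (Pi\<^sub>E {..<K} X) \<longleftrightarrow> (\<forall>i<K. snd (\<omega> i) = s i)"
      for \<omega> by (auto simp: prod_emb_iff restrict_PiE_iff Pi_iff)
    then show ?thesis unfolding sp by blast
  qed
  show "{\<omega> \<in> space (jump_sequences n). \<forall>i<K. snd (\<omega> i) = s i} \<in> sets (jump_sequences n)"
    unfolding set unfolding jump_sequences_def by (rule sets_PiM_I) (simp_all add: X)
  have one: "measure (jump_law n) (X i) = 1 / ?N" if "i < K" for i
  proof -
    have "s i \<in> transpositions n" using s that by auto
    then have "measure ?Q {s i} = 1 / ?N"
      using finite_transpositions[of n] by (subst measure_pmf_of_set) auto
    moreover have *: "emeasure (jump_law n) (X i) = emeasure ?E (space ?E) * emeasure ?Q {s i}"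
      unfolding X_def by (intro measure_pmf.emeasure_pair_measure_Times) auto
    then have "emeasure (jump_law n) (X i) = emeasure ?Q {s i}"
      unfolding E.emeasure_space_1 by simp
    ultimately show ?thesis by (simp add: measure_def)
  qed
  have "measure (jump_sequences n) (prod_emb UNIV (\<lambda>_. jump_law n) {..<K} (Pi\<^sub>E {..<K} X)) =
      (\<Prod>i<K. measure (jump_law n) (X i))"
    unfolding jump_sequences_def by (rule J.measure_PiM_emb) (simp_all add: X)
  also have "\<dots> = (\<Prod>i<K. 1 / ?N)" by (intro prod.cong one) auto
  also have "\<dots> = 1 / ?N ^ K" by (simp add: power_divide)
  finally show "measure (jump_sequences n) {\<omega> \<in> space (jump_sequences n). \<forall>i<K. snd (\<omega> i) = s i} =
      1 / ?N ^ K" unfolding set .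
qed

text \<open>Whether the level is reached within \<open>K\<close> steps inside \<open>A\<close> depends only on the first \<open>K\<close>
  transpositions, and these are uniform on all sequences of length \<open>K\<close>.\<close>

lemma hitting_distribution_ge:
  assumes n: "n \<ge> 2" and m: "\<lfloor>a * real n\<rfloor> = int m" "1 \<le> m"
  shows "avg (transpositions n) {..<K} (\<lambda>s. of_bool (first_hit_in n m K A s)) \<le>
    measure (hitting_distribution a n) A"
proof -
  let ?T = "transpositions n" let ?N = "real (card ?T)"
  let ?f = "\<lambda>\<omega>. walk (hitting_time a n \<omega>) \<omega>"
  let ?P = "jump_sequences n" and ?W = "walk_space n"
  define C where "C s = {\<omega> \<in> space ?P. \<forall>i<K. snd (\<omega> i) = s i}" for s :: "nat \<Rightarrow> nat \<Rightarrow> nat"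
  define Gd where "Gd = {s \<in> {..<K} \<rightarrow>\<^sub>E ?T. first_hit_in n m K A s}"
  interpret P: prob_space ?P by (rule prob_space_jump_sequences)
  interpret W: prob_space ?W
    by (rule prob_spaceI) (simp add: walk_space_eq P.emeasure_space_1)
  have fin: "finite ({..<K} \<rightarrow>\<^sub>E ?T)" by (intro finite_PiE finite_transpositions) auto
  then have finG: "finite Gd" unfolding Gd_def by simp
  have C: "C s \<in> sets ?P" "measure ?P (C s) = 1 / ?N ^ K" if "s \<in> Gd" for s
  proof -
    have "s \<in> {..<K} \<rightarrow>\<^sub>E ?T" using that by (simp add: Gd_def)
    then show "C s \<in> sets ?P" "measure ?P (C s) = 1 / ?N ^ K"
      unfolding C_def by (rule measure_first_jumps[OF n])+
  qed
  have disj: "disjoint_family_on C Gd"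
  proof (unfold disjoint_family_on_def, intro ballI impI)
    fix s s' assume s: "s \<in> Gd" "s' \<in> Gd" "s \<noteq> s'"
    then have "s \<in> {..<K} \<rightarrow>\<^sub>E ?T" "s' \<in> {..<K} \<rightarrow>\<^sub>E ?T" by (simp_all add: Gd_def)
    then have "\<exists>i<K. s i \<noteq> s' i" using s(3) PiE_ext[of s "{..<K}" "\<lambda>_. ?T" s'] by fastforce
    then show "C s \<inter> C s' = {}" unfolding C_def by auto
  qed
  have "avg ?T {..<K} (\<lambda>s. of_bool (first_hit_in n m K A s)) = real (card Gd) / ?N ^ K"
  proof -
    define S where "S = {..<K} \<rightarrow>\<^sub>E ?T"
    have "(\<Sum>s\<in>S. of_bool (first_hit_in n m K A s)) = real (card (S \<inter> {s. first_hit_in n m K A s}))"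
      using fin unfolding S_def[symmetric] by (intro sum_of_bool_eq)
    also have "S \<inter> {s. first_hit_in n m K A s} = Gd" unfolding S_def Gd_def by blast
    finally show ?thesis unfolding avg_def S_def by simp
  qed
  also have "\<dots> = (\<Sum>s\<in>Gd. 1 / ?N ^ K)" by simp
  also have "\<dots> = (\<Sum>s\<in>Gd. measure ?P (C s))"
    by (rule sum.cong[OF refl]) (rule C(2)[symmetric])
  also have "\<dots> = measure ?P (\<Union>s\<in>Gd. C s)"
    by (rule P.finite_measure_finite_Union[OF finG _ disj, symmetric]) (rule image_subsetI, rule C(1))
  also have "\<dots> = measure ?W (\<Union>s\<in>Gd. C s)"
    unfolding walk_space_eq
    by (rule measure_completion[symmetric]) (rule sets.finite_UN[OF finG], rule C(1))
  also have "\<dots> \<le> measure ?W (?f -` A \<inter> space ?W)"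
  proof (rule W.finite_measure_mono_AE)
    show "?f -` A \<inter> space ?W \<in> sets ?W"
      by (rule measurable_sets[OF measurable_walk_at_hitting_time[OF n m]]) simp
    show "AE \<omega> in ?W. \<omega> \<in> (\<Union>s\<in>Gd. C s) \<longrightarrow> \<omega> \<in> ?f -` A \<inter> space ?W"
      using AE_completion[OF AE_jump_sequences[OF n]] AE_space[of ?W] unfolding walk_space_eq[symmetric]
    proof eventually_elim
      case (elim \<omega>)
      have pos: "0 < fst (\<omega> i)" for i using elim(1) by simp
      show ?case
      proof
        assume "\<omega> \<in> (\<Union>s\<in>Gd. C s)"
        then obtain s where s: "first_hit_in n m K A s" "\<And>i. i < K \<Longrightarrow> snd (\<omega> i) = s i"
          by (auto simp: Gd_def C_def)
        from s(1) obtain k where k: "k \<le> K" "cayley_dist n (chain s k) = m"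
          "\<And>j. j < k \<Longrightarrow> cayley_dist n (chain s j) \<noteq> m" "chain s k \<in> A"
          unfolding first_hit_in_def by blast
        have c: "jump_chain \<omega> j = chain s j" if "j \<le> k" for j
          unfolding jump_chain_eq_chain using that k(1) by (intro chain_cong s(2)) auto
        have "hitting_time a n \<omega> = jump_time \<omega> k"
          using k c by (intro hitting_time_eq[OF pos m]) auto
        then show "\<omega> \<in> ?f -` A \<inter> space ?W"
          using k(4) c[of k] walk_at_jump_time[OF pos] elim by simp
      qed
    qed
  qed
  also have "\<dots> = measure (hitting_distribution a n) A"
    unfolding hitting_distribution_def
    by (rule measure_distr[symmetric, OF measurable_walk_at_hitting_time[OF n m]]) simp
  finally show ?thesis .
qed

lemma hitting_distribution_le_1:
  assumes n: "n \<ge> 2" and m: "\<lfloor>a * real n\<rfloor> = int m" "1 \<le> m"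
  shows "measure (hitting_distribution a n) A \<le> 1"
proof -
  interpret P: prob_space "jump_sequences n" by (rule prob_space_jump_sequences)
  have "prob_space (walk_space n)"
    by (rule prob_spaceI) (simp add: walk_space_eq P.emeasure_space_1)
  then have "prob_space (hitting_distribution a n)"
    unfolding hitting_distribution_def
    by (rule prob_space.prob_space_distr) (rule measurable_walk_at_hitting_time[OF n m])
  then show ?thesis by (rule prob_space.prob_le_1)
qed

section \<open>Asymptotics\<close>

definition level :: "real \<Rightarrow> nat \<Rightarrow> nat" where
  "level a n = nat \<lfloor>a * real n\<rfloor>"

lemma floor_level: "0 \<le> a \<Longrightarrow> \<lfloor>a * real n\<rfloor> = int (level a n)"
  by (simp add: level_def)

lemma level_le: "0 \<le> a \<Longrightarrow> real (level a n) \<le> a * real n"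
  using floor_level[of a n] of_int_floor_le[of "a * real n"] by simp

lemma level_ge: "0 \<le> a \<Longrightarrow> a * real n - 1 \<le> real (level a n)"
  using floor_level[of a n] real_of_int_floor_add_one_gt[of "a * real n"] by simp

lemma ball_boundary_eq:
  "0 \<le> a \<Longrightarrow> ball_boundary a n = {p. p permutes {1..n} \<and> cayley_dist n p = level a n}"
  unfolding ball_boundary_def by (simp add: floor_level)

lemma level_limit:
  assumes "0 \<le> a"
  shows "(\<lambda>n. real (level a n) / real n) \<longlonglongrightarrow> a"
proof (rule tendsto_sandwich)
  show "\<forall>\<^sub>F n in sequentially. (a * real n - 1) / real n \<le> real (level a n) / real n"
    using level_ge[OF assms] by (intro always_eventually allI divide_right_mono) auto
  show "\<forall>\<^sub>F n in sequentially. real (level a n) / real n \<le> a"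
    using eventually_gt_at_top[of 0] by eventually_elim (use level_le[OF assms] in \<open>simp add: field_simps\<close>)
  show "(\<lambda>n. (a * real n - 1) / real n) \<longlonglongrightarrow> a" by real_asymp
qed simp

lemma fixed_mean_limit:
  assumes "0 \<le> a"
  shows "(\<lambda>n. fixed_mean n (level a n) / real n) \<longlonglongrightarrow> exp (- 2 * a)"
proof -
  have "(\<lambda>n. real n * ln (1 - 2 / real n)) \<longlonglongrightarrow> - 2" by real_asymp
  then have "(\<lambda>n. exp (real (level a n) / real n * (real n * ln (1 - 2 / real n)))) \<longlonglongrightarrow> exp (a * (- 2))"
    by (intro tendsto_exp tendsto_mult level_limit assms)
  moreover have "\<forall>\<^sub>F n in sequentially.
      exp (real (level a n) / real n * (real n * ln (1 - 2 / real n))) = fixed_mean n (level a n) / real n"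
    using eventually_gt_at_top[of 2]
  proof eventually_elim
    case (elim n)
    have "0 < 1 - 2 / real n" using elim by simp
    then show ?case using elim by (simp add: fixed_mean_def exp_of_nat_mult)
  qed
  ultimately show ?thesis by (simp add: tendsto_cong mult.commute)
qed

lemma two_mean_limit:
  assumes "0 < a"
  shows "(\<lambda>n. two_mean n (level a n) / real n) \<longlonglongrightarrow> 2 * a * exp (- 4 * a)"
proof -
  let ?F = "\<lambda>n. fixed_mean n (level a n) / real n"
  have "(\<lambda>n. (1 - 2 / real n)\<^sup>2) \<longlonglongrightarrow> 1" by real_asymp
  then have "(\<lambda>n. 2 * (real (level a n) / real n) * (?F n)\<^sup>2 / (1 - 2 / real n)\<^sup>2) \<longlonglongrightarrow>
      2 * a * (exp (- 2 * a))\<^sup>2 / 1"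
    using assms by (intro tendsto_intros level_limit fixed_mean_limit) auto
  moreover have "(exp (- 2 * a))\<^sup>2 = exp (- 4 * a)" by (simp flip: exp_double)
  moreover have "\<forall>\<^sub>F n in sequentially.
      2 * (real (level a n) / real n) * (?F n)\<^sup>2 / (1 - 2 / real n)\<^sup>2 = two_mean n (level a n) / real n"
    using eventually_gt_at_top[of "nat \<lceil>2 + 1 / a\<rceil>"]
  proof eventually_elim
    case (elim n)
    then have n: "2 + 1 / a < real n" by linarith
    moreover have "0 < 1 / a" using assms by simp
    ultimately have n2: "2 < real n" by linarith
    have "1 / a < real n" using n by linarith
    then have "1 < a * real n" using assms by (simp add: field_simps)
    then obtain k where k: "level a n = Suc k"
      using level_ge[of a n] assms by (cases "level a n") auto
    define v where "v = (1 - 2 / real n)\<^sup>2"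
    have v: "v \<noteq> 0" using n2 unfolding v_def by simp
    have "(?F n)\<^sup>2 = v ^ level a n"
      unfolding fixed_mean_def v_def using n2 by (simp flip: power_mult add: mult.commute)
    then show ?case unfolding two_mean_def v_def[symmetric] using v k by simp
  qed
  ultimately show ?thesis by (simp add: tendsto_cong)
qed

text \<open>With \<open>c = 2 a\<close> this is \<open>c e\<^sup>-\<^sup>2\<^sup>c < e\<^sup>-\<^sup>c (1 - e\<^sup>-\<^sup>c)\<close>, that is, \<open>1 + c < e\<^sup>c\<close>. It says that from
  the permutations met by the walk there are more switches out than back.\<close>

lemma exponent_gap:
  assumes "0 < (a::real)"
  shows "2 * a * exp (- 4 * a) < exp (- 2 * a) * (1 - exp (- 2 * a))"
proof -
  have "ln (1 + 2 * a) < 2 * a" using assms by (intro ln_add_one_self_less_self) simp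
  then have "exp (ln (1 + 2 * a)) < exp (2 * a)" by simp
  then have "2 * a < exp (2 * a) - 1" using assms by simp
  then have "2 * a * exp (- 4 * a) < (exp (2 * a) - 1) * exp (- 4 * a)" by simp
  also have "\<dots> = exp (2 * a + - 4 * a) - exp (- 4 * a)" by (simp only: exp_add left_diff_distrib mult_1)
  also have "\<dots> = exp (- 2 * a) - exp (- 2 * a + - 2 * a)" by simp
  also have "\<dots> = exp (- 2 * a) * (1 - exp (- 2 * a))" by (simp only: exp_add right_diff_distrib mult_1_right)
  finally show ?thesis .
qed

text \<open>Any integer sequence that tends to infinity more slowly than \<open>n\<close> would do as an allowance for
  splits.\<close>

definition slack :: "nat \<Rightarrow> nat" where
  "slack n = nat \<lfloor>sqrt (real n)\<rfloor>"

lemma slack_bounds: "sqrt (real n) - 1 \<le> real (slack n)" "real (slack n) \<le> sqrt (real n)"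
  unfolding slack_def using of_int_floor_le[of "sqrt (real n)"] real_of_int_floor_add_one_gt[of "sqrt (real n)"]
  by simp_all

lemma slack_limit: "(\<lambda>n. real (slack n) / real n) \<longlonglongrightarrow> 0"
proof (rule tendsto_sandwich[where f = "\<lambda>_. 0" and h = "\<lambda>n. sqrt (real n) / real n"])
  show "\<forall>\<^sub>F n in sequentially. real (slack n) / real n \<le> sqrt (real n) / real n"
    using slack_bounds by (intro always_eventually allI divide_right_mono) auto
  show "(\<lambda>n. sqrt (real n) / real n) \<longlonglongrightarrow> 0" by real_asymp
qed auto

lemma slack_at_top: "filterlim (\<lambda>n. real (slack n)) at_top sequentially"
proof (rule filterlim_at_top_mono)
  show "filterlim (\<lambda>n. sqrt (real n) - 1) at_top sequentially" by real_asymp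
qed (use slack_bounds in auto)

lemma typical_hit_limit:
  fixes a \<epsilon> :: real
  assumes a: "0 < a" "a < 1 / 2" and \<epsilon>: "0 < \<epsilon>"
  obtains err :: "nat \<Rightarrow> real" where "err \<longlonglongrightarrow> 0"
    "\<forall>\<^sub>F n in sequentially. 1 - err n \<le> avg (transpositions n) {..<level a n + 2 * slack n}
      (\<lambda>s. of_bool (first_hit_in n (level a n) (level a n + 2 * slack n)
        (typical_set n (level a n) (\<epsilon> * n + 8 * real (slack n))) s))"
proof -
  \<comment> \<open>twice the limit \<open>1 / (1 - 2 a)\<close> of the bounds on the mean component size\<close>
  define B where "B = 2 / (1 - 2 * a)"
  define err where "err n = 2 * B / real (slack n) + 572 / (\<epsilon>\<^sup>2 * real n)" for n
  have B: "0 < B" using a by (simp add: B_def)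
  have "(\<lambda>n. 2 * B / real (slack n)) \<longlonglongrightarrow> 0"
    by (intro real_tendsto_divide_at_top[OF tendsto_const] slack_at_top)
  moreover have "(\<lambda>n. 572 / (\<epsilon>\<^sup>2 * real n)) \<longlonglongrightarrow> 0" using \<epsilon> by real_asymp
  ultimately have "err \<longlonglongrightarrow> 0 + 0" unfolding err_def by (intro tendsto_add)
  then have lim: "err \<longlonglongrightarrow> 0" by simp
  have "(\<lambda>n. 2 * (real (level a n) / real n) + 4 * (real (slack n) / real n)) \<longlonglongrightarrow> 2 * a + 4 * 0"
    using a by (intro tendsto_intros level_limit slack_limit) auto
  moreover have "2 * a + 4 * 0 < (1 + 2 * a) / 2" using a by simp
  ultimately have "\<forall>\<^sub>F n in sequentially.
      2 * (real (level a n) / real n) + 4 * (real (slack n) / real n) < (1 + 2 * a) / 2"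
    by (rule order_tendstoD)
  moreover have "\<forall>\<^sub>F n in sequentially. 1 \<le> real (slack n)"
    by (rule slack_at_top[unfolded filterlim_at_top, rule_format])
  ultimately have "\<forall>\<^sub>F n in sequentially. 1 - err n \<le> avg (transpositions n) {..<level a n + 2 * slack n}
      (\<lambda>s. of_bool (first_hit_in n (level a n) (level a n + 2 * slack n)
        (typical_set n (level a n) (\<epsilon> * n + 8 * real (slack n))) s))"
    using eventually_ge_at_top[of 2]
  proof eventually_elim
    case (elim n)
    let ?m = "level a n" and ?l = "slack n"
    let ?K = "?m + 2 * ?l"
    have n: "2 \<le> n" "0 < real n" using elim by auto
    define q where "q = 2 * real ?K / real n"
    have "q = 2 * (real ?m / real n) + 4 * (real ?l / real n)"
      unfolding q_def by (simp add: add_divide_distrib)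
    then have q: "q \<le> (1 + 2 * a) / 2" using elim by simp
    then have q1: "q \<le> 1" using a by simp
    have "(1 - 2 * a) / 2 * B \<le> (1 - q) * B" using q B by (intro mult_right_mono) auto
    moreover have "(1 - 2 * a) / 2 * B = 1" using a by (simp add: B_def)
    ultimately have "1 \<le> (1 - q) * B" by linarith
    then have qB: "1 + 2 * real ?K / real n * B \<le> B" unfolding q_def[symmetric] by (simp add: algebra_simps)
    have K: "real ?K \<le> real n" using q1 n unfolding q_def by (simp add: field_simps)
    then have m: "?m \<le> n" by simp
    have main: "1 - (real ?K * (B / (real n - 1)) / real ?l + 572 * real ?m / (\<epsilon> * n)\<^sup>2) \<le>
      avg (transpositions n) {..<?K} (\<lambda>s. of_bool (first_hit_in n ?m ?K (typical_set n ?m (\<epsilon> * n + 8 * real ?l)) s))"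
      by (rule typical_hit) (use elim m \<epsilon> B qB in auto)
    have "real ?K * (B / (real n - 1)) / real ?l \<le> 2 * B / real ?l"
    proof (rule divide_right_mono)
      have "real ?K * (B / (real n - 1)) \<le> real n * (B / (real n - 1))"
        using K B n by (intro mult_right_mono) auto
      also have "\<dots> \<le> 2 * B" using n B by (simp add: field_simps)
      finally show "real ?K * (B / (real n - 1)) \<le> 2 * B" .
    qed simp
    moreover have "572 * real ?m / (\<epsilon> * n)\<^sup>2 \<le> 572 * real n / (\<epsilon> * n)\<^sup>2"
      using m by (intro divide_right_mono) auto
    moreover have "572 * real n / (\<epsilon> * n)\<^sup>2 = 572 / (\<epsilon>\<^sup>2 * real n)"
      using n by (simp add: power2_eq_square)
    ultimately show ?case using main unfolding err_def by linarith
  qed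
  with lim show thesis by (rule that)
qed

lemma typical_set_small:
  assumes a: "0 < a"
  obtains \<epsilon> \<kappa> :: real where "0 < \<epsilon>" "0 < \<kappa>"
    "\<forall>\<^sub>F n in sequentially. exp (\<kappa> * n) * card (typical_set n (level a n) (\<epsilon> * n + 8 * real (slack n))) \<le>
       card (ball_boundary a n)"
proof -
  define \<phi> \<psi> where "\<phi> = exp (- 2 * a)" and "\<psi> = 2 * a * exp (- 4 * a)"
  \<comment> \<open>any \<open>\<delta>\<close> below the gap divided by \<open>14 = 5 + 9\<close> makes the growth factor \<open>r\<close> exceed 1\<close>
  define \<delta> where "\<delta> = (\<phi> * (1 - \<phi>) - \<psi>) / 20"
  define r where "r = (\<phi> * (1 - \<phi>) - 5 * \<delta>) / (\<psi> + 9 * \<delta>)"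
  \<comment> \<open>\<open>r\<^sup>L\<close> with \<open>L = \<lfloor>\<delta> n\<rfloor> \<ge> \<delta> n / 2\<close> is at least \<open>e\<^sup>\<kappa>\<^sup>n\<close>\<close>
  define \<kappa> where "\<kappa> = \<delta> * ln r / 2"
  have \<phi>: "0 \<le> \<phi>" "\<phi> \<le> 1" and \<psi>: "0 \<le> \<psi>" using a by (simp_all add: \<phi>_def \<psi>_def)
  have gap: "\<psi> < \<phi> * (1 - \<phi>)" unfolding \<phi>_def \<psi>_def by (rule exponent_gap[OF a])
  then have \<delta>: "0 < \<delta>" by (simp add: \<delta>_def)
  have den: "0 < \<psi> + 9 * \<delta>" using \<delta> \<psi> by simp
  have "\<psi> + 9 * \<delta> < \<phi> * (1 - \<phi>) - 5 * \<delta>"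
  proof -
    have "\<phi> * (1 - \<phi>) - \<psi> = 20 * \<delta>" by (simp add: \<delta>_def)
    then show ?thesis using \<delta> by linarith
  qed
  then have r: "1 < r" unfolding r_def using den by simp
  have rb: "r * (\<psi> + 9 * \<delta>) \<le> \<phi> * (1 - \<phi>) - 5 * \<delta>" unfolding r_def using den by simp
  have lnr: "0 < ln r" using r by simp
  have \<kappa>: "0 < \<kappa>" using \<delta> lnr by (simp add: \<kappa>_def)
  have "\<forall>\<^sub>F n in sequentially. \<bar>fixed_mean n (level a n) / real n - \<phi>\<bar> < \<delta> / 2"
    using tendstoD[OF fixed_mean_limit[of a], of "\<delta> / 2"] a \<delta> unfolding \<phi>_def dist_real_def by simp
  moreover have "\<forall>\<^sub>F n in sequentially. two_mean n (level a n) / real n < \<psi> + \<delta> / 2"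
    using order_tendstoD(2)[OF two_mean_limit[OF a], of "\<psi> + \<delta> / 2"] \<delta> unfolding \<psi>_def by simp
  moreover have "\<forall>\<^sub>F n in sequentially. real (slack n) / real n < \<delta> / 32"
    using order_tendstoD(2)[OF slack_limit, of "\<delta> / 32"] \<delta> by simp
  moreover have "\<forall>\<^sub>F n in sequentially. 2 / \<delta> < real n"
    using filterlim_real_sequentially by (simp add: filterlim_at_top_dense)
  ultimately have "\<forall>\<^sub>F n in sequentially.
      exp (\<kappa> * n) * card (typical_set n (level a n) (\<delta> / 4 * n + 8 * real (slack n))) \<le> card (ball_boundary a n)"
    using eventually_ge_at_top[of 1]
  proof eventually_elim
    case (elim n)
    let ?m = "level a n" and ?U = "typical_set n (level a n) (\<delta> / 4 * n + 8 * real (slack n))"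
    define L where "L = nat \<lfloor>\<delta> * real n\<rfloor>"
    have n: "0 < real n" using elim by simp
    have "0 \<le> \<delta> * real n" using \<delta> by simp
    then have L: "real L \<le> \<delta> * real n" "\<delta> * real n - 1 \<le> real L" unfolding L_def by linarith+
    have slk: "\<delta> / 4 * n + 8 * real (slack n) \<le> \<delta> / 2 * n"
      using elim(3) n by (simp add: field_simps)
    have "\<bar>fixed_mean n ?m / real n - \<phi>\<bar> * real n = \<bar>fixed_mean n ?m - \<phi> * n\<bar>"
    proof -
      have "(fixed_mean n ?m / real n - \<phi>) * real n = fixed_mean n ?m - \<phi> * n"
        using n by (simp add: left_diff_distrib)
      then show ?thesis using abs_mult[of "fixed_mean n ?m / real n - \<phi>" "real n"] by simp
    qed
    then have F: "\<bar>fixed_mean n ?m - \<phi> * n\<bar> \<le> \<delta> / 2 * n"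
      using mult_right_mono[OF less_imp_le[OF elim(1)], of "real n"] n by simp
    have Q: "two_mean n ?m \<le> (\<psi> + \<delta> / 2) * n"
      using elim(2) n by (simp add: field_simps)
    have U: "p permutes {1..n} \<and> cayley_dist n p = ?m \<and>
      \<bar>num_fixed n p - \<phi> * n\<bar> \<le> \<delta> * n \<and> num_two n p \<le> (\<psi> + \<delta>) * n" if p: "p \<in> ?U" for p
    proof -
      have p': "p permutes {1..n}" "cayley_dist n p = ?m"
        "\<bar>num_fixed n p - fixed_mean n ?m\<bar> \<le> \<delta> / 4 * n + 8 * real (slack n)"
        "num_two n p \<le> two_mean n ?m + (\<delta> / 4 * n + 8 * real (slack n))"
        using p unfolding typical_set_def by auto
      have d: "\<delta> * n = \<delta> / 2 * n + \<delta> / 2 * n" "(\<psi> + \<delta>) * n = (\<psi> + \<delta> / 2) * n + \<delta> / 2 * n"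
        by (simp_all add: algebra_simps)
      have "\<bar>num_fixed n p - \<phi> * n\<bar> \<le> \<delta> * n" using p'(3) slk F unfolding d by linarith
      moreover have "num_two n p \<le> (\<psi> + \<delta>) * n" using p'(4) slk Q unfolding d by linarith
      ultimately show ?thesis using p'(1,2) by simp
    qed
    have "r ^ L * card ?U \<le> card {p. p permutes {1..n} \<and> cayley_dist n p = ?m}"
      by (rule level_size_ge[OF _ U \<phi> \<psi> \<delta> _ rb L(1)]) (use elim r in auto)
    moreover have "exp (\<kappa> * n) \<le> r ^ L"
    proof -
      have "2 < \<delta> * n" using elim(4) \<delta> by (simp add: field_simps)
      then have "\<delta> * n / 2 \<le> real L" using L(2) by linarith
      then have "\<delta> * n / 2 * ln r \<le> real L * ln r" using lnr by (intro mult_right_mono) auto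
      then have "\<kappa> * n \<le> real L * ln r" by (simp add: \<kappa>_def algebra_simps)
      then have "exp (\<kappa> * n) \<le> exp (real L * ln r)" by simp
      also have "\<dots> = r ^ L" using r by (simp add: exp_of_nat_mult)
      finally show ?thesis .
    qed
    then have "exp (\<kappa> * n) * card ?U \<le> r ^ L * card ?U" by (intro mult_right_mono) auto
    ultimately show ?case unfolding ball_boundary_eq[OF less_imp_le[OF a]] by linarith
  qed
  then show thesis by (intro that[of "\<delta> / 4" \<kappa>]) (use \<delta> \<kappa> in auto)
qed

section \<open>The exponentially small support\<close>

text \<open>Rounding \<open>b e\<^sup>-\<^sup>\<kappa>\<^sup>n\<close> up to an integer at most doubles it once it is at least 1, which does not
  affect the exponential rate.\<close>

lemma enlarge_limit:
  fixes b c :: "nat \<Rightarrow> nat" and \<kappa> :: real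
  assumes "\<forall>\<^sub>F n in sequentially. 1 \<le> real (b n) * exp (- \<kappa> * n) \<and> c n = nat \<lceil>real (b n) * exp (- \<kappa> * n)\<rceil>"
  shows "(\<lambda>n. 1 / real n * ln (real (c n) / real (b n))) \<longlonglongrightarrow> - \<kappa>"
proof (rule tendsto_sandwich)
  have *: "\<forall>\<^sub>F n in sequentially. - \<kappa> \<le> 1 / real n * ln (real (c n) / real (b n)) \<and>
      1 / real n * ln (real (c n) / real (b n)) \<le> ln 2 / real n - \<kappa>"
    using assms eventually_gt_at_top[of 0]
  proof eventually_elim
    case (elim n)
    define x where "x = real (b n) * exp (- \<kappa> * n)"
    have x: "1 \<le> x" "x \<le> real (c n)" "real (c n) \<le> 2 * x"
      using elim unfolding x_def by linarith+
    have b: "0 < real (b n)"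
    proof (rule ccontr)
      assume "\<not> 0 < real (b n)"
      then show False using x(1) unfolding x_def by simp
    qed
    have xb: "x / real (b n) = exp (- \<kappa> * n)" using b by (simp add: x_def)
    have "x / real (b n) \<le> real (c n) / real (b n)" "real (c n) / real (b n) \<le> 2 * x / real (b n)"
      using x b by (auto intro: divide_right_mono)
    then have l: "exp (- \<kappa> * n) \<le> real (c n) / real (b n)" "real (c n) / real (b n) \<le> 2 * exp (- \<kappa> * n)"
      using xb by (simp_all flip: times_divide_eq_right)
    have pos: "0 < real (c n) / real (b n)" using l(1) exp_gt_zero[of "- \<kappa> * n"] by linarith
    have "ln (exp (- \<kappa> * n)) \<le> ln (real (c n) / real (b n))" using l(1) by (subst ln_le_cancel_iff) (use pos in auto)
    moreover have "ln (real (c n) / real (b n)) \<le> ln (2 * exp (- \<kappa> * n))"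
      using l(2) pos by (subst ln_le_cancel_iff) auto
    moreover have "ln (2 * exp (- \<kappa> * n)) = ln 2 + - \<kappa> * n" by (simp add: ln_mult)
    ultimately have "- \<kappa> * n \<le> ln (real (c n) / real (b n))" "ln (real (c n) / real (b n)) \<le> ln 2 + - \<kappa> * n"
      by simp_all
    then show ?case using elim(2) by (simp add: field_simps)
  qed
  show "\<forall>\<^sub>F n in sequentially. - \<kappa> \<le> 1 / real n * ln (real (c n) / real (b n))"
    using * by eventually_elim simp
  show "\<forall>\<^sub>F n in sequentially. 1 / real n * ln (real (c n) / real (b n)) \<le> ln 2 / real n - \<kappa>"
    using * by eventually_elim simp
  show "(\<lambda>n. ln 2 / real n - \<kappa>) \<longlonglongrightarrow> - \<kappa>" by real_asymp
qed simp

theorem theorem7: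
  fixes a :: real
  assumes "0 < a" and "a < 1/2"
  shows "\<exists>(S :: nat \<Rightarrow> (nat \<Rightarrow> nat) set) (\<gamma> :: real).
           \<gamma> < 0 \<and>
           (\<forall>n. S n \<subseteq> ball_boundary a n) \<and>
           (\<lambda>n. measure (hitting_distribution a n) (S n)) \<longlonglongrightarrow> 1 \<and>
           (\<lambda>n. 1 / real n * ln (real (card (S n)) / real (card (ball_boundary a n))))
              \<longlonglongrightarrow> \<gamma>"
proof -
  have a0: "0 \<le> a" using assms(1) by simp
  obtain \<epsilon> \<kappa> :: real where \<epsilon>: "0 < \<epsilon>" and \<kappa>: "0 < \<kappa>" and small:
    "\<forall>\<^sub>F n in sequentially. exp (\<kappa> * n) * card (typical_set n (level a n) (\<epsilon> * n + 8 * real (slack n))) \<le>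
       card (ball_boundary a n)"
    using typical_set_small[OF assms(1)] by blast
  define A where "A n = typical_set n (level a n) (\<epsilon> * n + 8 * real (slack n))" for n
  let ?B = "ball_boundary a"
  let ?x = "\<lambda>n. real (card (?B n)) * exp (- \<kappa> * n)"
  let ?hit = "\<lambda>n S. avg (transpositions n) {..<level a n + 2 * slack n}
      (\<lambda>s. of_bool (first_hit_in n (level a n) (level a n + 2 * slack n) S s))"
  obtain err where err: "err \<longlonglongrightarrow> 0" "\<forall>\<^sub>F n in sequentially. 1 - err n \<le> ?hit n (A n)"
    unfolding A_def using typical_hit_limit[OF assms \<epsilon>] by blast
  have AB: "A n \<subseteq> ?B n" for n
    unfolding A_def typical_set_def ball_boundary_eq[OF a0] by blast
  have finB: "finite (?B n)" for n
    by (rule finite_subset[OF _ finite_permutations[of "{1..n}"]]) (auto simp: ball_boundary_def)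
  have xB: "?x n \<le> card (?B n)" for n
    using \<kappa> by (intro mult_left_le) auto
  \<comment> \<open>the typical set is only known to be small; enlarging it to size \<open>c n\<close> gives an exact rate\<close>
  define c where "c n = nat \<lceil>?x n\<rceil>" for n
  have cB: "c n \<le> card (?B n)" for n
    using xB[of n] unfolding c_def by (simp add: ceiling_le_iff nat_le_iff)
  have "\<exists>S. S \<subseteq> ?B n \<and> (real (card (A n)) \<le> ?x n \<longrightarrow> A n \<subseteq> S \<and> card S = c n)" for n
  proof (cases "real (card (A n)) \<le> ?x n")
    case True
    then have "card (A n) \<le> c n" unfolding c_def by linarith
    then have "\<exists>S. A n \<subseteq> S \<and> S \<subseteq> ?B n \<and> card S = c n"
      by (rule exists_subset_between[OF _ cB AB finB])
    then show ?thesis by blast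
  qed auto
  then obtain S where S: "\<And>n. S n \<subseteq> ?B n"
    "\<And>n. real (card (A n)) \<le> ?x n \<Longrightarrow> A n \<subseteq> S n \<and> card (S n) = c n" by metis
  have Ax: "\<forall>\<^sub>F n in sequentially. real (card (A n)) \<le> ?x n"
    using small
  proof eventually_elim
    case (elim n)
    then have "exp (- \<kappa> * n) * (exp (\<kappa> * n) * card (A n)) \<le> exp (- \<kappa> * n) * card (?B n)"
      unfolding A_def by (intro mult_left_mono) auto
    moreover have "exp (- \<kappa> * n) * (exp (\<kappa> * n) * card (A n)) = card (A n)"
      by (simp add: exp_minus)
    ultimately show ?case by (simp only: mult.commute)
  qed
  \<comment> \<open>a nonempty \<open>A n\<close> forces \<open>1 \<le> ?x n\<close>, as rounding up in \<open>c n\<close> requires\<close>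
  have nonempty: "\<forall>\<^sub>F n in sequentially. A n \<noteq> {}"
  proof -
    have "\<forall>\<^sub>F n in sequentially. err n < 1" using order_tendstoD(2)[OF err(1), of 1] by simp
    then show ?thesis
      using err(2)
    proof eventually_elim
      case (elim n)
      have "?hit n {} = 0" by (simp add: first_hit_in_def avg_def)
      then show ?case using elim by auto
    qed
  qed
  have bounds: "\<forall>\<^sub>F n in sequentially. 1 - err n \<le> measure (hitting_distribution a n) (S n) \<and>
      measure (hitting_distribution a n) (S n) \<le> 1"
    using err(2) Ax eventually_gt_at_top[of "nat \<lceil>2 + 1 / a\<rceil>"]
  proof eventually_elim
    case (elim n)
    then have n: "2 + 1 / a < real n" by linarith
    moreover have "0 < 1 / a" using assms by simp
    ultimately have n2: "2 \<le> n" by linarith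
    have "1 / a < real n" using n by linarith
    then have "1 < a * real n" using assms by (simp add: field_simps)
    then have l: "1 \<le> level a n" unfolding level_def by linarith
    have "?hit n (A n) \<le> ?hit n (S n)"
      using S(2)[OF elim(2)] by (intro avg_mono) (auto simp: first_hit_in_def of_bool_def)
    also have "\<dots> \<le> measure (hitting_distribution a n) (S n)"
      by (rule hitting_distribution_ge[OF n2 floor_level[OF a0] l])
    finally show ?case
      using elim(1) hitting_distribution_le_1[OF n2 floor_level[OF a0] l] by auto
  qed
  have "(\<lambda>n. measure (hitting_distribution a n) (S n)) \<longlonglongrightarrow> 1"
  proof (rule tendsto_sandwich[where f = "\<lambda>n. 1 - err n" and h = "\<lambda>_. 1"])
    show "(\<lambda>n. 1 - err n) \<longlonglongrightarrow> 1" using tendsto_diff[OF tendsto_const err(1), of 1] by simp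
    show "\<forall>\<^sub>F n in sequentially. 1 - err n \<le> measure (hitting_distribution a n) (S n)"
      using bounds by eventually_elim simp
    show "\<forall>\<^sub>F n in sequentially. measure (hitting_distribution a n) (S n) \<le> 1"
      using bounds by eventually_elim simp
  qed simp
  moreover have "(\<lambda>n. 1 / real n * ln (real (card (S n)) / real (card (?B n)))) \<longlonglongrightarrow> - \<kappa>"
  proof (rule enlarge_limit)
    show "\<forall>\<^sub>F n in sequentially. 1 \<le> ?x n \<and> card (S n) = nat \<lceil>?x n\<rceil>"
      using Ax nonempty
    proof eventually_elim
      case (elim n)
      have "finite (A n)" using finite_subset[OF AB finB] .
      then have "1 \<le> card (A n)" using elim(2) by (simp add: Suc_le_eq card_gt_0_iff)
      then show ?case using elim(1) S(2)[OF elim(1)] unfolding c_def by linarith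
    qed
  qed
  ultimately show ?thesis using S(1) \<kappa> by (intro exI[of _ S] exI[of _ "- \<kappa>"]) auto
qed

end
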